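(* Let $d=2$ and let $\rho>0$. Let $g:\mathbb{R}^2\to[0,1]$ be a measurable function with $g(x)=g(-x)$ for all $x$ and $0<\int_{\mathbb{R}^2}g(x)\,dx<\infty$. Assume that $g$ is decreasing with $|x|$ (that is, $g(x)$ is a decreasing function of the $1$-norm $|x|$, in the weak sense: $|x|\le|y|$ implies $g(x)\ge g(y)$) and that $$\sup_{x\in\mathbb{R}^2}\frac{g(x)}{|x|^{-s}}<\infty$$ for some $s\ge 4$. Let $\mathcal{P}$ be a homogeneous Poisson point process of intensity $\rho$ on $\mathbb{R}^2$ and let $\operatorname{RCM}(\mathcal{P})$ be the random connection model on $\mathcal{P}$ with connection function $g$. Then, $P_\rho$-almost surely, the simple random walk on any connected component of $\operatorname{RCM}(\mathcal{P})$ is recurrent.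
   Context: $|\cdot|=|\cdot|_1$ denotes the $1$-norm on $\mathbb{R}^d$. Random connection model: let $\mathcal{P}=\{X_n\}$ be a homogeneous Poisson point process of intensity $\rho$ on $\mathbb{R}^d$. Given $\mathcal{P}$, each unordered pair of distinct points $X_i,X_j$ of $\mathcal{P}$ is joined by an (undirected) edge with probability $g(X_i-X_j)$, independently of all other pairs. The resulting random graph with vertex set $\mathcal{P}$ is $\operatorname{RCM}(\mathcal{P})$. $P_\rho$ denotes the joint law of the point process and the edge occupations. Under the integrability assumption on $g$, the graph $\operatorname{RCM}(\mathcal{P})$ is $P_\rho$-a.s. locally finite. Simple random walk: on a connected component, the walk is the Markov chain which at each step jumps to a uniformly chosen neighbor of its current position (all edges have conductance $1$). Degenerate components reduced to a single point are not considered. The walk on a connected graph is recurrent if for every starting vertex it returns to that vertex almost surely, and transient otherwise. *)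

theory Defs
  imports "HOL-Probability.Probability"
begin

definition norm1 :: "real^'d \<Rightarrow> real" where
  "norm1 x = (\<Sum>i\<in>UNIV. \<bar>x $ i\<bar>)"

section \<open>Simple random walk on a graph\<close>

text \<open>
  A simple undirected graph is given by a vertex set \<open>V\<close> and a symmetric irreflexive edge
  relation \<open>E\<close>; the neighbours of \<open>x\<close> form the set \<open>E `` {x}\<close>.
\<close>

definition graph_components :: "'a set \<Rightarrow> 'a rel \<Rightarrow> 'a set set" where
  "graph_components V E = V // {(x, y). x \<in> V \<and> y \<in> V \<and> (x, y) \<in> E\<^sup>*}"

definition srw_step :: "'a rel \<Rightarrow> 'a \<Rightarrow> 'a \<Rightarrow> real" where
  "srw_step E x y = (if (x, y) \<in> E then 1 / real (card (E `` {x})) else 0)"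

text \<open>
  \<open>N\<close> is the law, on the trajectory space of a connected component \<open>C\<close>, of the simple random walk
  on \<open>C\<close> started at \<open>v\<close>. The transition property is written without conditional probabilities:
  P(S_0 = p_0, ..., S_n = p_n, S_(n+1) = y) = P(S_0 = p_0, ..., S_n = p_n) * srw_step p_n y.
  On a countable component no such law exists if the walk can reach a vertex of degree zero
  or of infinite degree (where \<open>card\<close> is zero), because the transition probabilities out of that
  vertex do not sum to one.
\<close>

definition simple_random_walk :: "'a rel \<Rightarrow> 'a set \<Rightarrow> 'a \<Rightarrow> (nat \<Rightarrow> 'a) measure \<Rightarrow> bool" where
  "simple_random_walk E C v N \<longleftrightarrow>
     prob_space N \<and>
     sets N = sets (Pi\<^sub>M UNIV (\<lambda>_. count_space C)) \<and>
     (AE s in N. s 0 = v) \<and>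
     (\<forall>n p. \<forall>y\<in>C.
        measure N {s \<in> space N. (\<forall>k\<le>n. s k = p k) \<and> s (Suc n) = y} =
        measure N {s \<in> space N. \<forall>k\<le>n. s k = p k} * srw_step E (p n) y)"

text \<open>
  By \<open>simple_random_walk_unique\<close> and \<open>simple_random_walk_exists\<close> below, the law quantified here is
  unique, and exists whenever the component is locally finite and has at least two vertices.
  The existential form makes the existence of the walk part of recurrence.
\<close>

definition recurrent_component :: "'a rel \<Rightarrow> 'a set \<Rightarrow> bool" where
  "recurrent_component E C \<longleftrightarrow>
     (\<forall>v\<in>C. \<exists>N. simple_random_walk E C v N \<and> (AE s in N. \<exists>n>0. s n = v))"

lemma srw_cylinder_eq:
  assumes N: "simple_random_walk E C v N" "simple_random_walk E C v N'"
  shows "measure N {s \<in> space N. \<forall>k\<le>n. s k = p k} = measure N' {s \<in> space N'. \<forall>k\<le>n. s k = p k}"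
proof (induction n)
  case 0
  have *: "measure L {s \<in> space L. s 0 = p 0} = (if p 0 = v then 1 else 0)"
    if L: "simple_random_walk E C v L" for L
  proof -
    interpret prob_space L using L by (simp add: simple_random_walk_def)
    have AE: "AE s in L. s 0 = v" and sL: "sets L = sets (Pi\<^sub>M UNIV (\<lambda>_. count_space C))"
      using L by (auto simp: simple_random_walk_def)
    have [measurable]: "(\<lambda>s. s 0) \<in> L \<rightarrow>\<^sub>M count_space C"
      by (subst measurable_cong_sets[OF sL refl]) measurable
    have [measurable]: "{s \<in> space L. s 0 = p 0} \<in> sets L" by measurable
    show ?thesis
    proof (cases "p 0 = v")
      case True
      then have "prob {s \<in> space L. s 0 = p 0} = 1"
        using AE \<open>{s \<in> space L. s 0 = p 0} \<in> sets L\<close> by (subst prob_Collect_eq_1) simp_all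
      with True show ?thesis by simp
    next
      case False
      then have "prob {s \<in> space L. s 0 = p 0} = 0"
        using AE \<open>{s \<in> space L. s 0 = p 0} \<in> sets L\<close>
        by (subst prob_Collect_eq_0) auto
      with False show ?thesis by simp
    qed
  qed
  show ?case using *[OF N(1)] *[OF N(2)] by simp
next
  case (Suc n)
  have *: "measure L {s \<in> space L. \<forall>k\<le>Suc n. s k = p k} =
      (if p (Suc n) \<in> C then measure L {s \<in> space L. \<forall>k\<le>n. s k = p k} * srw_step E (p n) (p (Suc n)) else 0)"
    if L: "simple_random_walk E C v L" for L
  proof (cases "p (Suc n) \<in> C")
    case True
    have "{s \<in> space L. \<forall>k\<le>Suc n. s k = p k} = {s \<in> space L. (\<forall>k\<le>n. s k = p k) \<and> s (Suc n) = p (Suc n)}"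
      by (auto simp: le_Suc_eq)
    with True L show ?thesis by (simp add: simple_random_walk_def)
  next
    case False
    have "space L = UNIV \<rightarrow>\<^sub>E C"
      using L sets_eq_imp_space_eq[of L "Pi\<^sub>M UNIV (\<lambda>_. count_space C)"]
      by (simp add: simple_random_walk_def space_PiM)
    with False have "{s \<in> space L. \<forall>k\<le>Suc n. s k = p k} = {}"
      by (auto simp: PiE_iff) (metis le_refl)
    with False show ?thesis by (metis measure_empty)
  qed
  show ?case using *[OF N(1)] *[OF N(2)] Suc by simp
qed

lemma simple_random_walk_unique:
  assumes C: "countable C"
    and N: "simple_random_walk E C v N" "simple_random_walk E C v N'"
  shows "N = N'"
proof (rule measure_eqI_PiM_infinite)
  let ?M = "\<lambda>_::nat. count_space C"
  show s1: "sets N = sets (Pi\<^sub>M UNIV ?M)" and s2: "sets N' = sets (Pi\<^sub>M UNIV ?M)"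
    using N by (auto simp: simple_random_walk_def)
  interpret N: prob_space N using N by (simp add: simple_random_walk_def)
  interpret N': prob_space N' using N by (simp add: simple_random_walk_def)
  show "finite_measure N" by unfold_locales
  fix A and J :: "nat set"
  assume J: "finite J" "J \<subseteq> UNIV" and A: "\<And>i. i \<in> J \<Longrightarrow> A i \<in> sets (count_space C)"
  obtain m where m: "J \<subseteq> {..m}" using J finite_nat_iff_bounded_le by auto
  let ?f = "\<lambda>s::nat \<Rightarrow> 'a. restrict s {..m}"
  let ?K = "Pi\<^sub>M {..m} ?M"
  have K: "?K = count_space ({..m} \<rightarrow>\<^sub>E C)"
    using C by (simp add: count_space_PiM_finite)
  have cnt: "countable ({..m} \<rightarrow>\<^sub>E C)"
    using C by (auto intro: countable_PiE)
  have f: "?f \<in> L \<rightarrow>\<^sub>M ?K" if "sets L = sets (Pi\<^sub>M UNIV ?M)" for L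
    by (subst measurable_cong_sets[OF that refl]) (auto intro!: measurable_restrict)
  have D: "distr N ?K ?f = distr N' ?K ?f"
  proof (rule measure_eqI_countable[OF _ _ cnt])
    fix a assume a: "a \<in> {..m} \<rightarrow>\<^sub>E C"
    have V: "?f -` {a} \<inter> space L = {s \<in> space L. \<forall>k\<le>m. s k = a k}" for L :: "(nat \<Rightarrow> 'a) measure"
      using a by (auto simp: fun_eq_iff restrict_def PiE_iff extensional_def)
    have aK: "{a} \<in> sets ?K" using a by (simp add: K)
    show "emeasure (distr N ?K ?f) {a} = emeasure (distr N' ?K ?f) {a}"
      using srw_cylinder_eq[OF N, of m a]
      by (simp add: emeasure_distr[OF f[OF s1] aK] emeasure_distr[OF f[OF s2] aK] V
          N.emeasure_eq_measure N'.emeasure_eq_measure)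
  qed (simp_all add: K)
  let ?X = "Pi\<^sub>E J A"
  let ?Y = "prod_emb {..m} ?M J ?X"
  have X: "?X \<in> sets (Pi\<^sub>M J ?M)" using J A by (auto intro!: sets_PiM_I_finite)
  have Y: "?Y \<in> sets ?K" using m X by (rule measurable_prod_emb)
  have E: "?f -` ?Y \<inter> space L = prod_emb UNIV ?M J ?X" if "sets L = sets (Pi\<^sub>M UNIV ?M)" for L
  proof -
    have "space L = UNIV \<rightarrow>\<^sub>E C" using sets_eq_imp_space_eq[OF that] by (simp add: space_PiM)
    moreover have "{..m} \<inter> J = J" using m by auto
    ultimately show ?thesis
      using m by (auto simp: prod_emb_def space_PiM PiE_iff)
  qed
  have "emeasure (distr N ?K ?f) ?Y = emeasure (distr N' ?K ?f) ?Y" by (simp add: D)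
  then show "emeasure N (prod_emb UNIV ?M J ?X) = emeasure N' (prod_emb UNIV ?M J ?X)"
    by (simp add: emeasure_distr[OF f[OF s1] Y] emeasure_distr[OF f[OF s2] Y] E s1 s2)
qed

lemma simple_random_walk_exists:
  assumes C: "countable C" and v: "v \<in> C"
    and E: "\<And>x. x \<in> C \<Longrightarrow> E `` {x} \<subseteq> C \<and> finite (E `` {x}) \<and> E `` {x} \<noteq> {}"
  shows "\<exists>N. simple_random_walk E C v N"
proof -
  let ?M = "\<lambda>_::nat. count_space C"
  define Q where "Q n w = (if n = 0 then return (count_space C) v
      else density (count_space C) (\<lambda>y. ennreal (srw_step E (w (n - 1)) y)))"
    for n :: nat and w :: "nat \<Rightarrow> 'a"
  have fin: "Pi\<^sub>M {0..<n} ?M = count_space ({0..<n} \<rightarrow>\<^sub>E C)" for n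
    using C by (simp add: count_space_PiM_finite)
  have prob: "prob_space (density (count_space C) (\<lambda>y. ennreal (srw_step E x y)))" if x: "x \<in> C" for x
  proof
    have "(\<integral>\<^sup>+y. ennreal (srw_step E x y) \<partial>count_space C) = (\<Sum>y\<in>E `` {x}. ennreal (srw_step E x y))"
      using E[OF x] by (intro nn_integral_count_space') (auto simp: srw_step_def)
    also have "\<dots> = ennreal (\<Sum>y\<in>E `` {x}. 1 / real (card (E `` {x})))"
      by (subst sum_ennreal[symmetric]) (auto simp: srw_step_def intro!: sum.cong)
    also have "\<dots> = 1" using E[OF x] by simp
    finally show "emeasure (density (count_space C) (\<lambda>y. ennreal (srw_step E x y)))
       (space (density (count_space C) (\<lambda>y. ennreal (srw_step E x y)))) = 1"
      by (subst emeasure_density) (auto intro: trans[OF nn_integral_cong])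
  qed
  have probQ: "prob_space (Q n w)" if "w \<in> {0..<n} \<rightarrow>\<^sub>E C" for n w
    using that v by (auto simp: Q_def PiE_iff intro!: prob_space_return prob)
  have setsQ: "sets (Q n w) = sets (count_space C)" for n w
    by (simp add: Q_def)
  interpret IT: Ionescu_Tulcea Q ?M
  proof (rule Ionescu_Tulcea.intro, goal_cases)
    case (1 n) show "Q n \<in> Pi\<^sub>M {0..<n} ?M \<rightarrow>\<^sub>M subprob_algebra (count_space C)"
      unfolding fin
      by (auto simp: space_subprob_algebra setsQ intro!: prob_space_imp_subprob_space probQ)
  next
    case (2 n w)
    then show "prob_space (Q n w)" by (auto simp: space_PiM intro: probQ)
  qed
  let ?u = "\<lambda>_::nat. undefined :: 'a"
  have C_Suc: "emeasure (IT.C 0 (Suc n) ?u) {restrict p {0..<Suc n}} =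
      emeasure (IT.C 0 n ?u) {restrict p {0..<n}} * emeasure (Q n p) {p n}"
    if p: "\<And>k. p k \<in> C" for n p
  proof -
    let ?r = "\<lambda>n. restrict p {0..<n}"
    have r: "?r n \<in> {0..<n} \<rightarrow>\<^sub>E C" for n using p by auto
    have sC: "sets (IT.C 0 n ?u) = sets (Pi\<^sub>M {0..<n} ?M)" for n
      using IT.sets_C[of ?u 0 n] by (simp add: space_PiM)
    have sp: "space (IT.C 0 n ?u) = {0..<n} \<rightarrow>\<^sub>E C"
      using sets_eq_imp_space_eq[OF sC] by (simp add: space_PiM)
    have "emeasure (IT.C 0 (Suc n) ?u) {?r (Suc n)} =
       (\<integral>\<^sup>+w. emeasure (IT.eP n w) {?r (Suc n)} \<partial>IT.C 0 n ?u)"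
      unfolding IT.C.simps add_0
    proof (rule emeasure_bind)
      show "space (IT.C 0 n ?u) \<noteq> {}" using sp r[of n] by (metis empty_iff)
      show "IT.eP n \<in> IT.C 0 n ?u \<rightarrow>\<^sub>M subprob_algebra (Pi\<^sub>M {0..<Suc n} ?M)"
        by (subst measurable_cong_sets[OF sC refl]) (rule IT.measurable_eP)
      show "{?r (Suc n)} \<in> sets (Pi\<^sub>M {0..<Suc n} ?M)" using r[of "Suc n"] unfolding fin by simp
    qed
    also have "\<dots> = (\<integral>\<^sup>+w. emeasure (Q n p) {p n} * indicator {?r n} w \<partial>IT.C 0 n ?u)"
    proof (rule nn_integral_cong)
      fix w assume "w \<in> space (IT.C 0 n ?u)"
      then have w: "w \<in> {0..<n} \<rightarrow>\<^sub>E C" by (simp add: sp)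
      have "emeasure (IT.eP n w) {?r (Suc n)} =
          emeasure (Q n w) ((\<lambda>x. w(n := x)) -` {?r (Suc n)} \<inter> space (count_space C))"
        using w r[of "Suc n"] by (intro IT.emeasure_eP) (auto simp: space_PiM fin)
      also have "(\<lambda>x. w(n := x)) -` {?r (Suc n)} \<inter> space (count_space C) = (if w = ?r n then {p n} else {})"
      proof -
        have "w(n := x) = ?r (Suc n) \<longleftrightarrow> w = ?r n \<and> x = p n" for x
        proof
          assume a: "w(n := x) = ?r (Suc n)"
          have "w k = ?r n k" for k
            using w fun_cong[OF a, of k] by (cases "k < n") (auto simp: PiE_iff extensional_def)
          moreover have "x = p n" using fun_cong[OF a, of n] by simp
          ultimately show "w = ?r n \<and> x = p n" by auto
        next
          assume "w = ?r n \<and> x = p n"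
          then show "w(n := x) = ?r (Suc n)" by (auto simp: fun_eq_iff restrict_def)
        qed
        then have "(\<lambda>x. w(n := x)) -` {?r (Suc n)} = {x. w = ?r n \<and> x = p n}"
          by (auto simp: set_eq_iff)
        then show ?thesis using p[of n] by (simp add: Collect_conv_if)
      qed
      also have "emeasure (Q n w) (if w = ?r n then {p n} else {}) = emeasure (Q n p) {p n} * indicator {?r n} w"
        by (auto simp: Q_def indicator_def restrict_def)
      finally show "emeasure (IT.eP n w) {?r (Suc n)} = emeasure (Q n p) {p n} * indicator {?r n} w" .
    qed
    also have "\<dots> = emeasure (Q n p) {p n} * emeasure (IT.C 0 n ?u) {?r n}"
      using r[of n] by (intro nn_integral_cmult_indicator) (simp add: sC fin)
    finally show ?thesis by (simp add: mult.commute)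
  qed
  define N where "N = IT.PF.lim"
  interpret N: prob_space N unfolding N_def
  proof (rule prob_space_distrD)
    show "(\<lambda>s. restrict s {}) \<in> IT.PF.lim \<rightarrow>\<^sub>M Pi\<^sub>M {} ?M"
      by (subst measurable_cong_sets[OF IT.PF.sets_lim refl]) (intro measurable_restrict_subset, simp)
    show "prob_space (distr IT.PF.lim (Pi\<^sub>M {} ?M) (\<lambda>s. restrict s {}))"
      by (subst IT.distr_lim) (auto intro: IT.PF.prob_space_P)
  qed
  have sN: "sets N = sets (Pi\<^sub>M UNIV ?M)" by (simp add: N_def)
  have spN: "space N = UNIV \<rightarrow>\<^sub>E C" using sets_eq_imp_space_eq[OF sN] by (simp add: space_PiM)
  have cyl: "emeasure N {s \<in> space N. \<forall>k<n. s k = p k} = emeasure (IT.C 0 n ?u) {restrict p {0..<n}}"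
    if p: "\<And>k. p k \<in> C" for n p
  proof -
    let ?r = "restrict p {0..<n}"
    have r: "{?r} \<in> sets (Pi\<^sub>M {0..<n} ?M)" using p unfolding fin by auto
    have eq: "{s \<in> space N. \<forall>k<n. s k = p k} = prod_emb UNIV ?M {0..<n} {?r}"
      by (auto simp: prod_emb_def spN fun_eq_iff restrict_def space_PiM) metis
    have "emeasure N {s \<in> space N. \<forall>k<n. s k = p k} = emeasure (IT.CI {0..<n}) {?r}"
      unfolding eq unfolding N_def by (rule IT.lim[OF _ r]) simp
    also have "\<dots> = emeasure (IT.C 0 n ?u) (prod_emb {0..<n} ?M {0..<n} {?r})"
      by (rule IT.emeasure_CI[OF _ r]) simp
    also have "prod_emb {0..<n} ?M {0..<n} {?r} = {?r}"
      using p by (intro prod_emb_id) auto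
    finally show ?thesis .
  qed
  have step: "measure N {s \<in> space N. (\<forall>k<n. s k = p k) \<and> s n = p n} =
       measure N {s \<in> space N. \<forall>k<n. s k = p k} * measure (Q n p) {p n}"
    if p: "\<And>k. p k \<in> C" for n p
  proof -
    interpret Q: prob_space "Q n p"
    proof -
      have "prob_space (Q n (restrict p {0..<n}))" using p by (intro probQ) auto
      also have "Q n (restrict p {0..<n}) = Q n p" by (simp add: Q_def)
      finally show "prob_space (Q n p)" .
    qed
    have "{s \<in> space N. (\<forall>k<n. s k = p k) \<and> s n = p n} = {s \<in> space N. \<forall>k<Suc n. s k = p k}"
      by (auto simp: less_Suc_eq)
    then have "emeasure N {s \<in> space N. (\<forall>k<n. s k = p k) \<and> s n = p n} =
       emeasure N {s \<in> space N. \<forall>k<n. s k = p k} * emeasure (Q n p) {p n}"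
      using cyl[OF p, of "Suc n"] cyl[OF p, of n] C_Suc[OF p, of n] by simp
    then show ?thesis
      by (simp add: N.emeasure_eq_measure Q.emeasure_eq_measure ennreal_mult'[symmetric])
  qed
  have "simple_random_walk E C v N"
    unfolding simple_random_walk_def
  proof (intro conjI allI ballI)
    show "prob_space N" by unfold_locales
    show "sets N = sets (Pi\<^sub>M UNIV ?M)" by (fact sN)
    have "measure N {s \<in> space N. s 0 = v} = 1"
      using step[of "\<lambda>_. v" 0] v by (simp add: Q_def N.prob_space measure_return)
    then show "AE s in N. s 0 = v"
      using N.AE_prob_1 by fastforce
  next
    fix n p y assume y: "y \<in> C"
    show "measure N {s \<in> space N. (\<forall>k\<le>n. s k = p k) \<and> s (Suc n) = y} =
        measure N {s \<in> space N. \<forall>k\<le>n. s k = p k} * srw_step E (p n) y"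
    proof (cases "\<forall>k\<le>n. p k \<in> C")
      case False
      then have "{s \<in> space N. (\<forall>k\<le>n. s k = p k) \<and> s (Suc n) = y} = {}"
          "{s \<in> space N. \<forall>k\<le>n. s k = p k} = {}"
        by (auto simp: spN PiE_iff) (metis)+
      then show ?thesis by (metis measure_empty mult_zero_left)
    next
      case True
      define q where "q k = (if k \<le> n then p k else y)" for k
      have q: "q k \<in> C" for k using True y by (auto simp: q_def)
      have "measure (Q (Suc n) q) {y} = srw_step E (p n) y"
        using y by (simp add: Q_def q_def measure_def emeasure_density
            nn_integral_count_space_indicator srw_step_def)
      moreover have "{s \<in> space N. (\<forall>k<Suc n. s k = q k) \<and> s (Suc n) = q (Suc n)} =
          {s \<in> space N. (\<forall>k\<le>n. s k = p k) \<and> s (Suc n) = y}"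
        "{s \<in> space N. \<forall>k<Suc n. s k = q k} = {s \<in> space N. \<forall>k\<le>n. s k = p k}"
        by (auto simp: q_def less_Suc_eq_le)
      ultimately show ?thesis using step[of q "Suc n", OF q]
        by (simp add: q_def[of "Suc n"])
    qed
  qed
  then show ?thesis ..
qed

section \<open>The random connection model\<close>

text \<open>
  \<open>P w\<close> is the set of points of a homogeneous Poisson point process of intensity \<open>\<rho>\<close>. The number
  of points in a bounded Borel set \<open>B\<close> has the Poisson distribution with parameter \<open>\<rho>\<close> times the
  Lebesgue measure of \<open>B\<close> (parameter zero, i.e. the Dirac mass at zero, included).
\<close>

locale poisson_point_process = prob_space M for M :: "'w measure" +
  fixes \<rho> :: real and P :: "'w \<Rightarrow> 'b::euclidean_space set"
  assumes locally_finite: "AE w in M. \<forall>B. bounded B \<longrightarrow> finite (P w \<inter> B)"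
    and poisson_counts:
      "\<And>B k. bounded B \<Longrightarrow> B \<in> sets borel \<Longrightarrow>
        prob {w \<in> space M. card (P w \<inter> B) = k} =
          exp (- (\<rho> * measure lborel B)) * (\<rho> * measure lborel B) ^ k / fact k"
    and indep_counts:
      "\<And>\<B>. finite \<B> \<Longrightarrow> disjoint \<B> \<Longrightarrow> (\<And>B. B \<in> \<B> \<Longrightarrow> bounded B \<and> B \<in> sets borel) \<Longrightarrow>
        indep_vars (\<lambda>_. count_space UNIV) (\<lambda>B w. card (P w \<inter> B)) \<B>"

text \<open>
  \<open>X\<close> is a measurable enumeration of the points and \<open>E w\<close> is the set of edges, as a symmetric
  relation on points. An unordered pair of distinct points is represented by its pair of indices
  \<open>i < j\<close>. Given the points, i.e. given the sigma-algebra generated by the sequence \<open>X\<close>,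
  the probability that all edges from a given finite set are present is the product of the
  connection probabilities. As such events form a pi-system that generates the edge
  configuration, this is conditional independence of all the edges.
\<close>

locale random_connection_model =
  poisson_point_process M \<rho> "\<lambda>w. range (\<lambda>n. X n w)"
  for M :: "'w measure" and \<rho> :: real and X :: "nat \<Rightarrow> 'w \<Rightarrow> 'b::euclidean_space" +
  fixes g :: "'b \<Rightarrow> real" and E :: "'w \<Rightarrow> 'b rel"
  assumes points_measurable: "\<And>n. X n \<in> borel_measurable M"
    and points_distinct: "AE w in M. inj (\<lambda>n. X n w)"
    and edges_graph:
      "\<And>w. w \<in> space M \<Longrightarrow>
        E w \<subseteq> range (\<lambda>n. X n w) \<times> range (\<lambda>n. X n w) \<and> sym (E w) \<and> irrefl (E w)"
    and edges_measurable: "\<And>i j. i < j \<Longrightarrow> {w \<in> space M. (X i w, X j w) \<in> E w} \<in> sets M"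
    and edges_conditional_law:
      "\<And>F. finite F \<Longrightarrow> F \<subseteq> {(i, j). i < j} \<Longrightarrow>
        AE w in M.
          real_cond_exp M (vimage_algebra (space M) (\<lambda>w n. X n w) (Pi\<^sub>M UNIV (\<lambda>_. borel)))
            (indicator {w \<in> space M. \<forall>(i, j)\<in>F. (X i w, X j w) \<in> E w}) w =
          (\<Prod>(i, j)\<in>F. g (X i w - X j w))"

end

theory Submission
  imports Defs "HOL-Real_Asymp.Real_Asymp"
begin

text \<open>
  Recurrence at a vertex \<open>v\<close> means that the effective conductance from \<open>v\<close> to infinity vanishes,
  that is, that there are finitely supported functions \<open>f\<close> with \<open>f v\<close> bounded below and with
  arbitrarily small Dirichlet energy, the sum of \<open>(f x - f y)\<^sup>2\<close> over the edges. For the random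
  connection model a deterministic choice of \<open>f\<close> suffices, and only the mean of its energy has to
  be estimated.

  By the Campbell formula (\<open>edge_functional_mean\<close>) the mean energy is the integral of
  \<open>\<rho>\<^sup>2 * (f x - f y)\<^sup>2 * g (x - y)\<close>. The hypothesis bounds \<open>g\<close> by a multiple of
  \<open>1 / (1 + norm x) ^ 4\<close>, which in the plane is the critical decay. For a radial function, the edges at distance
  about \<open>r\<close> from the origin with length \<open>l \<le> r\<close> contribute \<open>f'(r)\<^sup>2\<close> times the integral of
  \<open>l\<^sup>2 * l ^ (- 4) * l\<close>, that is \<open>f'(r)\<^sup>2 * ln r\<close>, and the longer edges contribute less. So the mean
  energy is of the order of the integral of \<open>f'(r)\<^sup>2 * r * ln r\<close>. For \<open>f\<close> descending from 1 to 0 like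
  \<open>1 - ln (ln r) / n\<close> the integrand is \<open>1 / (n\<^sup>2 * r * ln r)\<close>, whose integral up to the radius where
  \<open>ln (ln r) = n\<close> is of order \<open>1 / n\<close> (\<open>nn_integral_log_cutoff_energy_le\<close>). Hence the mean energies tend to
  zero, and almost surely the energies come arbitrarily close to zero along the sequence. The same sequence of
  functions serves all vertices of all components.

  The passage from small energy to recurrence is deterministic (\<open>recurrent_if_small_energy\<close>). It
  avoids flows and finite-volume approximation: the probability \<open>h\<close> of hitting \<open>v\<close> is positive and
  harmonic off \<open>v\<close>, and a Hardy inequality with weight \<open>h\<close> bounds the probability of never
  returning to \<open>v\<close> directly by the energy of \<open>f\<close>.
\<close>

section \<open>Recurrence from test functions of small energy\<close>

text \<open>
  The difference of the two sides is the square \<open>(a t - b s)\<^sup>2 / (s t)\<close>. Applied on every edge, with \<open>s\<close> and \<open>t\<close>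
  the values of a positive superharmonic function, this turns an energy bound into a bound on the
  Laplacian of that function.
\<close>

lemma edge_energy_ge:
  fixes a b s t :: real
  assumes "0 < s" "0 < t"
  shows "(s - t) * (a\<^sup>2 / s - b\<^sup>2 / t) \<le> (a - b)\<^sup>2"
proof -
  have "(a - b)\<^sup>2 - (s - t) * (a\<^sup>2 / s - b\<^sup>2 / t) = (a * t - b * s)\<^sup>2 / (s * t)"
  proof -
    have "(a\<^sup>2 / s - b\<^sup>2 / t) * (s * t) = a\<^sup>2 * t - b\<^sup>2 * s"
      using assms by (simp add: left_diff_distrib)
    then have "((a - b)\<^sup>2 - (s - t) * (a\<^sup>2 / s - b\<^sup>2 / t)) * (s * t) =
        (a - b)\<^sup>2 * (s * t) - (s - t) * (a\<^sup>2 * t - b\<^sup>2 * s)"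
      by (simp only: left_diff_distrib mult.assoc)
    also have "\<dots> = (a * t - b * s)\<^sup>2"
      by (simp add: algebra_simps power2_eq_square)
    finally show ?thesis using assms by (simp add: eq_divide_eq)
  qed
  moreover have "0 \<le> (a * t - b * s)\<^sup>2 / (s * t)" using assms by simp
  ultimately show ?thesis by linarith
qed

locale locally_finite_component =
  fixes E :: "'a rel" and C :: "'a set"
  assumes countable_C: "countable C"
    and sym_E: "sym E"
    and nbrs_subset: "\<And>x. x \<in> C \<Longrightarrow> E `` {x} \<subseteq> C"
    and nbrs_finite: "\<And>x. x \<in> C \<Longrightarrow> finite (E `` {x})"
    and nbrs_nonempty: "\<And>x. x \<in> C \<Longrightarrow> E `` {x} \<noteq> {}"
    and connected: "\<And>x y. x \<in> C \<Longrightarrow> y \<in> C \<Longrightarrow> (x, y) \<in> E\<^sup>*"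
begin

definition nbr_mean :: "('a \<Rightarrow> real) \<Rightarrow> 'a \<Rightarrow> real" where
  "nbr_mean u x = (\<Sum>y\<in>E `` {x}. u y) / real (card (E `` {x}))"

text \<open>
  This is the probability that the walk started at \<open>x\<close> is at \<open>v\<close> at one of the times \<open>0, ..., n\<close>,
  computed by conditioning on the first step. Its recursion makes monotonicity and the passage to
  the limit elementary; the link with the trajectories is made in \<open>no_return_prob\<close>.
\<close>

primrec hit_within :: "'a \<Rightarrow> nat \<Rightarrow> 'a \<Rightarrow> real" where
  "hit_within v 0 x = (if x = v then 1 else 0)"
| "hit_within v (Suc n) x = (if x = v then 1 else nbr_mean (hit_within v n) x)"

lemma card_nbrs_pos: "x \<in> C \<Longrightarrow> 0 < real (card (E `` {x}))"
  using nbrs_finite nbrs_nonempty by (simp add: card_gt_0_iff)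

lemma nbr_mean_mono:
  assumes "\<And>y. y \<in> E `` {x} \<Longrightarrow> u y \<le> w y"
  shows "nbr_mean u x \<le> nbr_mean w x"
  using assms by (auto simp: nbr_mean_def intro!: divide_right_mono sum_mono)

lemma nbr_mean_const: "x \<in> C \<Longrightarrow> nbr_mean (\<lambda>_. c) x = c"
  using card_nbrs_pos by (simp add: nbr_mean_def)

lemma sum_nbrs_complement:
  assumes "x \<in> C"
  shows "(\<Sum>y\<in>E `` {x}. c * (1 / real (card (E `` {x}))) * (1 - u y)) = c * (1 - nbr_mean u x)"
proof -
  have "(\<Sum>y\<in>E `` {x}. c * (1 / real (card (E `` {x}))) * (1 - u y)) =
      c * (1 / real (card (E `` {x}))) * (real (card (E `` {x})) - (\<Sum>y\<in>E `` {x}. u y))"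
    by (simp only: sum_distrib_left[symmetric] sum_subtractf sum_constant) simp
  also have "\<dots> = c * (1 - nbr_mean u x)"
    using card_nbrs_pos[OF assms] by (simp add: nbr_mean_def right_diff_distrib diff_divide_distrib)
  finally show ?thesis .
qed

lemma hit_within_bounds:
  assumes "x \<in> C"
  shows "0 \<le> hit_within v n x" "hit_within v n x \<le> 1"
proof -
  have "x \<in> C \<longrightarrow> 0 \<le> hit_within v n x \<and> hit_within v n x \<le> 1" for x
  proof (induction n arbitrary: x)
    case (Suc n)
    show ?case
    proof
      assume x: "x \<in> C"
      have "nbr_mean (\<lambda>_. 0) x \<le> nbr_mean (hit_within v n) x"
        "nbr_mean (hit_within v n) x \<le> nbr_mean (\<lambda>_. 1) x"
        using Suc nbrs_subset[OF x] by (auto intro!: nbr_mean_mono)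
      then show "0 \<le> hit_within v (Suc n) x \<and> hit_within v (Suc n) x \<le> 1"
        by (simp add: nbr_mean_const[OF x])
    qed
  qed simp
  then show "0 \<le> hit_within v n x" "hit_within v n x \<le> 1" using assms by auto
qed

lemma hit_within_Suc_mono: "x \<in> C \<Longrightarrow> hit_within v n x \<le> hit_within v (Suc n) x"
proof (induction n arbitrary: x)
  case 0
  then show ?case using hit_within_bounds(1)[of x v 1] by auto
next
  case (Suc n)
  have "nbr_mean (hit_within v n) x \<le> nbr_mean (hit_within v (Suc n)) x"
    using Suc.IH nbrs_subset[OF Suc.prems] by (intro nbr_mean_mono) blast
  then show ?case by simp
qed

definition hit_prob :: "'a \<Rightarrow> 'a \<Rightarrow> real" where
  "hit_prob v x = lim (\<lambda>n. hit_within v n x)"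

lemma hit_within_tendsto: "x \<in> C \<Longrightarrow> (\<lambda>n. hit_within v n x) \<longlonglongrightarrow> hit_prob v x"
proof -
  assume x: "x \<in> C"
  have "Bseq (\<lambda>n. hit_within v n x)"
    using hit_within_bounds[OF x] by (intro BseqI'[of _ 1]) (simp add: abs_le_iff)
  moreover have "incseq (\<lambda>n. hit_within v n x)"
    using hit_within_Suc_mono[OF x] by (rule incseq_SucI)
  ultimately have "convergent (\<lambda>n. hit_within v n x)"
    by (intro Bseq_monoseq_convergent) (auto simp: monoseq_iff)
  then show ?thesis by (simp add: hit_prob_def convergent_LIMSEQ_iff)
qed

lemma hit_within_le_hit_prob: "x \<in> C \<Longrightarrow> hit_within v n x \<le> hit_prob v x"
  by (rule incseq_le[OF incseq_SucI[of "\<lambda>n. hit_within v n x"] hit_within_tendsto])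
     (rule hit_within_Suc_mono)

lemma nbr_mean_hit_within_tendsto:
  assumes "x \<in> C"
  shows "(\<lambda>n. nbr_mean (hit_within v n) x) \<longlonglongrightarrow> nbr_mean (hit_prob v) x"
  unfolding nbr_mean_def
  using hit_within_tendsto nbrs_subset[OF assms] card_nbrs_pos[OF assms]
  by (intro tendsto_intros) auto

lemma hit_prob_self: "v \<in> C \<Longrightarrow> hit_prob v v = 1"
proof -
  assume v: "v \<in> C"
  have "(\<lambda>n. hit_within v n v) = (\<lambda>n. 1)"
  proof
    fix n show "hit_within v n v = 1" by (cases n) auto
  qed
  then show ?thesis using hit_within_tendsto[OF v, of v] LIMSEQ_unique[OF tendsto_const] by metis
qed

lemma hit_prob_harmonic:
  assumes "x \<in> C" "x \<noteq> v"
  shows "hit_prob v x = nbr_mean (hit_prob v) x"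
proof -
  have "(\<lambda>n. hit_within v (Suc n) x) \<longlonglongrightarrow> hit_prob v x"
    using hit_within_tendsto[OF assms(1)] by (rule LIMSEQ_Suc)
  with nbr_mean_hit_within_tendsto[OF assms(1), of v] assms(2) show ?thesis
    by (auto intro: LIMSEQ_unique)
qed

text \<open>
  Positivity is transported along a path from \<open>v\<close>: by harmonicity the value at \<open>z\<close> is an average of
  nonnegative values, one of which is the value at the previous vertex of the path.
\<close>

lemma hit_prob_pos:
  assumes v: "v \<in> C" and x: "x \<in> C"
  shows "0 < hit_prob v x"
proof -
  have "(v, x) \<in> E\<^sup>*" using v x by (rule connected)
  then have "x \<in> C \<and> 0 < hit_prob v x"
  proof induction
    case base
    show ?case using v by (simp add: hit_prob_self)
  next
    case (step y z)
    have z: "z \<in> C" using step nbrs_subset by blast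
    show ?case
    proof (cases "z = v")
      case False
      have yz: "y \<in> E `` {z}" using step sym_E by (auto dest: symD)
      have "0 \<le> hit_prob v u" if "u \<in> E `` {z}" for u
        using that nbrs_subset[OF z] hit_within_bounds(1) hit_within_le_hit_prob order_trans by blast
      then have "0 < (\<Sum>u\<in>E `` {z}. hit_prob v u)"
        using yz step.IH nbrs_finite[OF z] by (intro sum_pos2[of _ y]) auto
      then show ?thesis
        using z card_nbrs_pos[OF z] hit_prob_harmonic[OF z False] by (simp add: nbr_mean_def)
    qed (use v in \<open>simp add: hit_prob_self\<close>)
  qed
  then show ?thesis by simp
qed

text \<open>
  Doob's transform, in the form of a Hardy inequality. Summing \<open>edge_energy_ge\<close> over the edges, with
  \<open>h\<close> the hitting probability of \<open>v\<close>, and summing by parts gives \<open>2 \<Sum>x. \<phi> x * deg x * (h x - mean of h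
  around x)\<close> with \<open>\<phi> = f\<^sup>2 / h\<close>. As \<open>h\<close> is harmonic off \<open>v\<close>, only the term of \<open>v\<close> survives, and there the
  Laplacian is the probability of never returning. The factor 2 is there because \<open>E\<close> contains each edge in
  both directions.
\<close>

lemma hardy_inequality:
  assumes v: "v \<in> C" and F: "finite {x \<in> C. f x \<noteq> 0}"
  shows "ennreal (2 * real (card (E `` {v})) * (f v)\<^sup>2 * (1 - nbr_mean (hit_prob v) v)) \<le>
    (\<integral>\<^sup>+(x, y). ennreal ((f x - f y)\<^sup>2) \<partial>count_space E)"
proof -
  let ?h = "hit_prob v"
  define F' where "F' = insert v {x \<in> C. f x \<noteq> 0}"
  \<comment> \<open>\<open>A\<close> collects the oriented edges that start in the support; the summation by parts needs a set
    that is closed under reversal, hence \<open>B\<close>. On the edges of \<open>B\<close> outside \<open>A\<close> the weight \<open>\<phi>\<close> of the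
    initial vertex vanishes.\<close>
  define A where "A = (SIGMA x:F'. E `` {x})"
  define B where "B = A \<union> A\<inverse>"
  define \<phi> where "\<phi> x = (f x)\<^sup>2 / ?h x" for x
  have F': "finite F'" "F' \<subseteq> C" using v F by (auto simp: F'_def)
  have A: "finite A" "A \<subseteq> E" using F' nbrs_finite by (auto simp: A_def intro!: finite_SigmaI)
  have B: "finite B" "B \<subseteq> E" using A sym_E by (auto simp: B_def dest: symD)
  have BC: "x \<in> C \<and> y \<in> C" if "(x, y) \<in> B" for x y
    using that F' nbrs_subset by (auto simp: B_def A_def)
  have symB: "B\<inverse> = B" by (auto simp: B_def)
  have "(\<Sum>(x, y)\<in>B. (?h x - ?h y) * (- \<phi> y)) = (\<Sum>(x, y)\<in>B\<inverse>. (?h x - ?h y) * \<phi> x)"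
    by (rule sum.reindex_bij_witness[of _ prod.swap prod.swap])
       (auto simp: algebra_simps)
  then have "(\<Sum>(x, y)\<in>B. (?h x - ?h y) * (\<phi> x - \<phi> y)) = 2 * (\<Sum>(x, y)\<in>B. (?h x - ?h y) * \<phi> x)"
    by (simp add: symB case_prod_beta algebra_simps sum_subtractf sum.distrib sum_negf)
  also have "(\<Sum>(x, y)\<in>B. (?h x - ?h y) * \<phi> x) = (\<Sum>(x, y)\<in>A. (?h x - ?h y) * \<phi> x)"
  proof (rule sum.mono_neutral_right)
    have "\<phi> x = 0" if "(x, y) \<in> B - A" for x y
    proof -
      have "x \<in> C" "(x, y) \<in> E" using that BC B by auto
      then show ?thesis using that by (auto simp: A_def F'_def \<phi>_def)
    qed
    then show "\<forall>i\<in>B - A. (case i of (x, y) \<Rightarrow> (?h x - ?h y) * \<phi> x) = 0" by auto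
  qed (use B in \<open>auto simp: B_def\<close>)
  also have "\<dots> = (\<Sum>x\<in>F'. \<phi> x * (real (card (E `` {x})) * (?h x - nbr_mean ?h x)))"
  proof -
    have "(\<Sum>y\<in>E `` {x}. (?h x - ?h y) * \<phi> x) = \<phi> x * (real (card (E `` {x})) * (?h x - nbr_mean ?h x))"
      if "x \<in> F'" for x
    proof -
      have "0 < real (card (E `` {x}))" using card_nbrs_pos F' that by auto
      then have "real (card (E `` {x})) * (?h x - nbr_mean ?h x) = (\<Sum>y\<in>E `` {x}. ?h x - ?h y)"
        by (simp add: nbr_mean_def sum_subtractf right_diff_distrib)
      then show ?thesis by (simp only: sum_distrib_right[symmetric]) simp
    qed
    then show ?thesis
      unfolding A_def using F' nbrs_finite by (subst sum.Sigma[symmetric]) (auto intro!: sum.cong)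
  qed
  also have "\<dots> = (\<Sum>x\<in>F'. if x = v then \<phi> v * (real (card (E `` {v})) * (1 - nbr_mean ?h v)) else 0)"
    using F' hit_prob_harmonic hit_prob_self[OF v] by (intro sum.cong) auto
  also have "\<dots> = (f v)\<^sup>2 * (real (card (E `` {v})) * (1 - nbr_mean ?h v))"
    using F' by (simp add: F'_def \<phi>_def hit_prob_self[OF v])
  finally have "2 * real (card (E `` {v})) * (f v)\<^sup>2 * (1 - nbr_mean ?h v) =
      (\<Sum>(x, y)\<in>B. (?h x - ?h y) * (\<phi> x - \<phi> y))" by simp
  also have "\<dots> \<le> (\<Sum>(x, y)\<in>B. (f x - f y)\<^sup>2)"
    unfolding \<phi>_def using BC hit_prob_pos[OF v]
    by (intro sum_mono) (auto intro!: edge_energy_ge)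
  finally have "ennreal (2 * real (card (E `` {v})) * (f v)\<^sup>2 * (1 - nbr_mean ?h v)) \<le>
      ennreal (\<Sum>(x, y)\<in>B. (f x - f y)\<^sup>2)" by (rule ennreal_leI)
  also have "\<dots> = (\<integral>\<^sup>+(x, y). ennreal ((f x - f y)\<^sup>2) \<partial>count_space B)"
    using B by (simp add: nn_integral_count_space_finite case_prod_beta sum_ennreal)
  also have "\<dots> \<le> (\<integral>\<^sup>+(x, y). ennreal ((f x - f y)\<^sup>2) \<partial>count_space E)"
  proof -
    have "(\<integral>\<^sup>+(x, y). ennreal ((f x - f y)\<^sup>2) \<partial>count_space B) =
      (\<integral>\<^sup>+e. (case e of (x, y) \<Rightarrow> ennreal ((f x - f y)\<^sup>2)) * indicator B e \<partial>count_space E)"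
      using B by (subst nn_integral_restrict_space[symmetric]) (auto simp: restrict_count_space Int_absorb2)
    also have "\<dots> \<le> (\<integral>\<^sup>+(x, y). ennreal ((f x - f y)\<^sup>2) \<partial>count_space E)"
      by (intro nn_integral_mono) (auto simp: indicator_def)
    finally show ?thesis .
  qed
  finally show ?thesis .
qed

text \<open>
  The events on the right only cover the steps to a neighbour. The other steps are null because the
  transition probabilities to the finitely many neighbours already sum to one.
\<close>

lemma measure_split_by_next_step:
  assumes N: "simple_random_walk E C v N" and pk: "p k \<in> C"
    and A: "A \<in> sets N" "A \<subseteq> {s. \<forall>j\<le>k. s j = p j}"
  shows "measure N A = (\<Sum>y\<in>E `` {p k}. measure N {s \<in> A. s (Suc k) = y})"
proof -
  interpret prob_space N using N by (simp add: simple_random_walk_def)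
  let ?D = "E `` {p k}"
  define P where "P = {s \<in> space N. \<forall>j\<le>k. s j = p j}"
  have sN: "sets N = sets (Pi\<^sub>M UNIV (\<lambda>_. count_space C))"
    using N by (simp add: simple_random_walk_def)
  have [measurable]: "(\<lambda>s. s j) \<in> N \<rightarrow>\<^sub>M count_space C" for j
    by (subst measurable_cong_sets[OF sN refl]) measurable
  have Pm: "P \<in> sets N" unfolding P_def by measurable
  have Dy: "{s \<in> space N. s (Suc k) = y} \<in> sets N" for y by measurable
  \<comment> \<open>The decomposition with its remainder is used twice: for the whole cylinder \<open>P\<close>, to see that the
    remainder is null, and then for \<open>A\<close>.\<close>
  have split: "prob B = (\<Sum>y\<in>?D. prob {s \<in> B. s (Suc k) = y}) + prob {s \<in> B. s (Suc k) \<notin> ?D}"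
    if B: "B \<in> sets N" for B
  proof -
    have sub: "{s \<in> B. s (Suc k) = y} = B \<inter> {s \<in> space N. s (Suc k) = y}" for y
      using sets.sets_into_space[OF B] by auto
    have By: "{s \<in> B. s (Suc k) = y} \<in> sets N" for y
      unfolding sub using B Dy by auto
    have U: "(\<Union>y\<in>?D. {s \<in> B. s (Suc k) = y}) \<in> sets N"
      using By nbrs_finite[OF pk] by auto
    have rest: "{s \<in> B. s (Suc k) \<notin> ?D} = B - (\<Union>y\<in>?D. {s \<in> B. s (Suc k) = y})" by auto
    have "prob (\<Union>y\<in>?D. {s \<in> B. s (Suc k) = y}) = (\<Sum>y\<in>?D. prob {s \<in> B. s (Suc k) = y})"
      using By nbrs_finite[OF pk] by (intro finite_measure_finite_Union) (auto simp: disjoint_family_on_def)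
    moreover have "prob {s \<in> B. s (Suc k) \<notin> ?D} = prob B - prob (\<Union>y\<in>?D. {s \<in> B. s (Suc k) = y})"
      unfolding rest using B U by (intro finite_measure_Diff) auto
    ultimately show ?thesis by simp
  qed
  have "prob {s \<in> P. s (Suc k) = y} = prob P * (1 / real (card ?D))" if "y \<in> ?D" for y
  proof -
    have "y \<in> C" using that nbrs_subset[OF pk] by auto
    then have "prob {s \<in> space N. (\<forall>j\<le>k. s j = p j) \<and> s (Suc k) = y} = prob P * srw_step E (p k) y"
      using N by (simp add: simple_random_walk_def P_def)
    moreover have "{s \<in> space N. (\<forall>j\<le>k. s j = p j) \<and> s (Suc k) = y} = {s \<in> P. s (Suc k) = y}"
      by (auto simp: P_def)
    ultimately show ?thesis using that by (simp add: srw_step_def)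
  qed
  then have "(\<Sum>y\<in>?D. prob {s \<in> P. s (Suc k) = y}) = (\<Sum>y\<in>?D. prob P * (1 / real (card ?D)))"
    by (rule sum.cong[OF refl])
  also have "\<dots> = prob P"
    using card_nbrs_pos[OF pk] by simp
  finally have "(\<Sum>y\<in>?D. prob {s \<in> P. s (Suc k) = y}) = prob P" .
  with split[OF Pm] have zero: "prob {s \<in> P. s (Suc k) \<notin> ?D} = 0" by linarith
  have "{s \<in> P. s (Suc k) \<notin> ?D} = P - (\<Union>y\<in>?D. {s \<in> space N. s (Suc k) = y})"
    by (auto simp: P_def)
  also have "\<dots> \<in> sets N" using Pm Dy nbrs_finite[OF pk]
    by (intro sets.Diff sets.finite_UN) auto
  finally have "{s \<in> P. s (Suc k) \<notin> ?D} \<in> sets N" .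
  moreover have "A \<subseteq> P"
    using A(2) sets.sets_into_space[OF A(1)] unfolding P_def by blast
  ultimately have "prob {s \<in> A. s (Suc k) \<notin> ?D} \<le> prob {s \<in> P. s (Suc k) \<notin> ?D}"
    by (intro finite_measure_mono) blast+
  with zero have "prob {s \<in> A. s (Suc k) \<notin> ?D} = 0"
    using measure_nonneg[of N "{s \<in> A. s (Suc k) \<notin> ?D}"] by linarith
  with split[OF A(1)] show ?thesis by linarith
qed

text \<open>
  This is the Markov property at time \<open>k\<close>. The induction on \<open>m\<close> extends the prescribed past by one
  step, so the past \<open>p\<close> and its length must stay arbitrary.
\<close>

lemma avoid_prob:
  assumes N: "simple_random_walk E C v N"
  shows "p k \<in> C \<Longrightarrow>
    measure N {s \<in> space N. (\<forall>j\<le>k. s j = p j) \<and> (\<forall>j\<in>{k..k+m}. s j \<noteq> v)} =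
    measure N {s \<in> space N. \<forall>j\<le>k. s j = p j} * (1 - hit_within v m (p k))"
proof (induction m arbitrary: k p)
  case 0
  show ?case
  proof (cases "p k = v")
    case True
    then have e: "{s \<in> space N. (\<forall>j\<le>k. s j = p j) \<and> (\<forall>j\<in>{k..k+0}. s j \<noteq> v)} = {}" by auto
    show ?thesis unfolding e using True by simp
  next
    case False
    then have e: "{s \<in> space N. (\<forall>j\<le>k. s j = p j) \<and> (\<forall>j\<in>{k..k+0}. s j \<noteq> v)} =
      {s \<in> space N. \<forall>j\<le>k. s j = p j}" by auto
    show ?thesis unfolding e using False by simp
  qed
next
  case (Suc m)
  let ?D = "E `` {p k}"
  let ?P = "{s \<in> space N. \<forall>j\<le>k. s j = p j}"
  let ?A = "{s \<in> space N. (\<forall>j\<le>k. s j = p j) \<and> (\<forall>j\<in>{k..k+Suc m}. s j \<noteq> v)}"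
  have sN: "sets N = sets (Pi\<^sub>M UNIV (\<lambda>_. count_space C))"
    using N by (simp add: simple_random_walk_def)
  have [measurable]: "(\<lambda>s. s j) \<in> N \<rightarrow>\<^sub>M count_space C" for j
    by (subst measurable_cong_sets[OF sN refl]) measurable
  show ?case
  proof (cases "p k = v")
    case True
    then have e: "?A = {}" by auto
    show ?thesis unfolding e using True by simp
  next
    case False
    have "?A \<in> sets N" by measurable
    then have "measure N ?A = (\<Sum>y\<in>?D. measure N {s \<in> ?A. s (Suc k) = y})"
      by (intro measure_split_by_next_step[where p = p and k = k, OF N Suc.prems]) auto
    also have "\<dots> = (\<Sum>y\<in>?D. measure N ?P * (1 / real (card ?D)) * (1 - hit_within v m y))"
    proof (rule sum.cong)
      fix y assume y: "y \<in> ?D"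
      then have yC: "y \<in> C" using nbrs_subset[OF Suc.prems] by auto
      let ?p = "p(Suc k := y)"
      have "{s \<in> ?A. s (Suc k) = y} =
          {s \<in> space N. (\<forall>j\<le>Suc k. s j = ?p j) \<and> (\<forall>j\<in>{Suc k..Suc k+m}. s j \<noteq> v)}"
      proof -
        have "{k..k+Suc m} = insert k {Suc k..Suc k+m}" by auto
        then show ?thesis using False by (auto simp: le_Suc_eq)
      qed
      then have "measure N {s \<in> ?A. s (Suc k) = y} =
          measure N {s \<in> space N. \<forall>j\<le>Suc k. s j = ?p j} * (1 - hit_within v m y)"
        using Suc.IH[of ?p "Suc k"] yC by simp
      also have "{s \<in> space N. \<forall>j\<le>Suc k. s j = ?p j} =
          {s \<in> space N. (\<forall>j\<le>k. s j = p j) \<and> s (Suc k) = y}"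
        by (auto simp: le_Suc_eq)
      also have "measure N \<dots> = measure N ?P * srw_step E (p k) y"
        using N yC by (simp add: simple_random_walk_def)
      finally show "measure N {s \<in> ?A. s (Suc k) = y} =
          measure N ?P * (1 / real (card ?D)) * (1 - hit_within v m y)"
        using y by (simp add: srw_step_def)
    qed simp
    also have "\<dots> = measure N ?P * (1 - nbr_mean (hit_within v m) (p k))"
      by (rule sum_nbrs_complement[OF Suc.prems])
    finally show ?thesis using False by simp
  qed
qed

text \<open>
  The time 0 is excluded from the return, so the first step is split off by hand and \<open>avoid_prob\<close>
  is applied from time 1 on, with the past that consists of \<open>v\<close> and the first neighbour visited.
\<close>

lemma no_return_prob:
  assumes N: "simple_random_walk E C v N" and v: "v \<in> C"
  shows "measure N {s \<in> space N. s 0 = v \<and> (\<forall>j\<in>{1..Suc m}. s j \<noteq> v)} =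
    1 - nbr_mean (hit_within v m) v"
proof -
  interpret prob_space N using N by (simp add: simple_random_walk_def)
  let ?D = "E `` {v}"
  let ?A = "{s \<in> space N. s 0 = v \<and> (\<forall>j\<in>{1..Suc m}. s j \<noteq> v)}"
  have sN: "sets N = sets (Pi\<^sub>M UNIV (\<lambda>_. count_space C))"
    using N by (simp add: simple_random_walk_def)
  have [measurable]: "(\<lambda>s. s j) \<in> N \<rightarrow>\<^sub>M count_space C" for j
    by (subst measurable_cong_sets[OF sN refl]) measurable
  have start: "prob {s \<in> space N. s 0 = v} = 1"
  proof -
    have "AE s in N. s 0 = v" using N by (simp add: simple_random_walk_def)
    then show ?thesis by (subst prob_Collect_eq_1) auto
  qed
  have "?A \<in> sets N" by measurable
  then have "prob ?A = (\<Sum>y\<in>?D. prob {s \<in> ?A. s (Suc 0) = y})"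
    using measure_split_by_next_step[OF N, of "\<lambda>_. v" 0 ?A] v by auto
  also have "\<dots> = (\<Sum>y\<in>?D. (1 / real (card ?D)) * (1 - hit_within v m y))"
  proof (rule sum.cong)
    fix y assume y: "y \<in> ?D"
    then have yC: "y \<in> C" using nbrs_subset[OF v] by auto
    let ?p = "\<lambda>j::nat. if j = 0 then v else y"
    have "{s \<in> ?A. s (Suc 0) = y} =
        {s \<in> space N. (\<forall>j\<le>1. s j = ?p j) \<and> (\<forall>j\<in>{1..1+m}. s j \<noteq> v)}"
      by (auto simp: le_Suc_eq)
    then have "prob {s \<in> ?A. s (Suc 0) = y} =
        prob {s \<in> space N. \<forall>j\<le>1. s j = ?p j} * (1 - hit_within v m y)"
      using avoid_prob[OF N, of ?p 1 m] yC by simp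
    also have "{s \<in> space N. \<forall>j\<le>1. s j = ?p j} =
        {s \<in> space N. (\<forall>j\<le>0. s j = ?p j) \<and> s (Suc 0) = y}"
      by (auto simp: le_Suc_eq)
    also have "prob \<dots> = prob {s \<in> space N. \<forall>j\<le>0. s j = ?p j} * srw_step E (?p 0) y"
    proof -
      have "\<forall>n p. \<forall>y\<in>C. prob {s \<in> space N. (\<forall>k\<le>n. s k = p k) \<and> s (Suc n) = y} =
          prob {s \<in> space N. \<forall>k\<le>n. s k = p k} * srw_step E (p n) y"
        using N by (simp add: simple_random_walk_def)
      from bspec[OF spec[OF spec[OF this, of 0], of ?p] yC] show ?thesis .
    qed
    finally show "prob {s \<in> ?A. s (Suc 0) = y} = (1 / real (card ?D)) * (1 - hit_within v m y)"
      using y start by (simp add: srw_step_def)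
  qed simp
  also have "\<dots> = 1 - nbr_mean (hit_within v m) v"
    using sum_nbrs_complement[OF v, of 1] by simp
  finally show ?thesis .
qed

lemma recurrent_if_return_certain:
  assumes "\<And>v. v \<in> C \<Longrightarrow> nbr_mean (hit_prob v) v = 1"
  shows "recurrent_component E C"
  unfolding recurrent_component_def
proof
  fix v assume v: "v \<in> C"
  obtain N where N: "simple_random_walk E C v N"
    using simple_random_walk_exists[OF countable_C v] nbrs_subset nbrs_finite nbrs_nonempty by metis
  interpret prob_space N using N by (simp add: simple_random_walk_def)
  have sN: "sets N = sets (Pi\<^sub>M UNIV (\<lambda>_. count_space C))"
    using N by (simp add: simple_random_walk_def)
  have [measurable]: "(\<lambda>s. s j) \<in> N \<rightarrow>\<^sub>M count_space C" for j
    by (subst measurable_cong_sets[OF sN refl]) measurable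
  let ?Z = "{s \<in> space N. s 0 = v \<and> (\<forall>n>0. s n \<noteq> v)}"
  have Z: "?Z \<in> sets N" by measurable
  have "prob ?Z \<le> 1 - nbr_mean (hit_within v m) v" for m
    unfolding no_return_prob[OF N v, symmetric] by (intro finite_measure_mono) auto
  moreover have "(\<lambda>m. 1 - nbr_mean (hit_within v m) v) \<longlonglongrightarrow> 1 - nbr_mean (hit_prob v) v"
    by (intro tendsto_intros nbr_mean_hit_within_tendsto v)
  ultimately have "prob ?Z \<le> 1 - nbr_mean (hit_prob v) v"
    by (intro LIMSEQ_le_const) auto
  then have "prob ?Z = 0" using assms[OF v] by (simp add: measure_le_0_iff)
  then have "AE s in N. \<not> (s 0 = v \<and> (\<forall>n>0. s n \<noteq> v))"
    using Z by (subst (asm) prob_Collect_eq_0) auto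
  moreover have "AE s in N. s 0 = v" using N by (simp add: simple_random_walk_def)
  ultimately have "AE s in N. \<exists>n>0. s n = v" by eventually_elim auto
  with N show "\<exists>N. simple_random_walk E C v N \<and> (AE s in N. \<exists>n>0. s n = v)" by blast
qed

text \<open>
  One half of the Dirichlet principle for recurrence: functions of finite support that stay above
  \<open>1/2\<close> at \<open>v\<close> and have arbitrarily small energy leave, by \<open>hardy_inequality\<close>, no room for a
  positive probability \<open>q\<close> of never returning to \<open>v\<close>.
\<close>

theorem recurrent_if_small_energy:
  assumes small: "\<And>v \<epsilon>. v \<in> C \<Longrightarrow> 0 < \<epsilon> \<Longrightarrow> \<exists>f. finite {x \<in> C. f x \<noteq> 0} \<and> 1/2 \<le> f v \<and>
      (\<integral>\<^sup>+(x, y). ennreal ((f x - f y)\<^sup>2) \<partial>count_space E) < ennreal \<epsilon>"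
  shows "recurrent_component E C"
proof (rule recurrent_if_return_certain)
  fix v assume v: "v \<in> C"
  define q where "q = 1 - nbr_mean (hit_prob v) v"
  have "nbr_mean (hit_within v m) v \<le> 1" for m
    using nbr_mean_mono[of v "hit_within v m" "\<lambda>_. 1"] hit_within_bounds(2) nbrs_subset[OF v]
      nbr_mean_const[OF v, of 1] by auto
  then have q0: "0 \<le> q"
    using LIMSEQ_le_const2[OF nbr_mean_hit_within_tendsto[OF v]] by (auto simp: q_def)
  show "nbr_mean (hit_prob v) v = 1"
  proof (rule ccontr)
    assume "nbr_mean (hit_prob v) v \<noteq> 1"
    with q0 have q: "0 < q" by (simp add: q_def)
    \<comment> \<open>The degree is at least 1, so the left side of the Hardy inequality is at least
      \<open>2 * 1 * (1/2)\<^sup>2 * q = q / 2\<close>.\<close>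
    obtain f where f: "finite {x \<in> C. f x \<noteq> 0}" "1/2 \<le> f v"
      "(\<integral>\<^sup>+(x, y). ennreal ((f x - f y)\<^sup>2) \<partial>count_space E) < ennreal (q / 2)"
      using small[OF v, of "q / 2"] q by auto
    have "(1/2)\<^sup>2 \<le> (f v)\<^sup>2" using f(2) by (intro power_mono) auto
    moreover have "1 \<le> real (card (E `` {v}))" using card_nbrs_pos[OF v] by simp
    ultimately have "2 * 1 * (1/2)\<^sup>2 * q \<le> 2 * real (card (E `` {v})) * (f v)\<^sup>2 * q"
      using q by (intro mult_mono) auto
    then have "q / 2 \<le> 2 * real (card (E `` {v})) * (f v)\<^sup>2 * q" by (simp add: power2_eq_square)
    then have "ennreal (q / 2) \<le> ennreal (2 * real (card (E `` {v})) * (f v)\<^sup>2 * q)" by (rule ennreal_leI)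
    also have "\<dots> \<le> (\<integral>\<^sup>+(x, y). ennreal ((f x - f y)\<^sup>2) \<partial>count_space E)"
      unfolding q_def by (rule hardy_inequality[OF v f(1)])
    finally show False using f(3) by simp
  qed
qed

end

text \<open>
  A component with a second vertex has no isolated vertices: each vertex is joined to some other
  vertex by a nonempty path, whose first edge provides a neighbour.
\<close>

lemma locally_finite_component_of_graph:
  assumes V: "countable V" and E: "E \<subseteq> V \<times> V" "sym E"
    and fin: "\<And>x. finite (E `` {x})"
    and C: "C \<in> graph_components V E" "\<not> is_singleton C"
  shows "locally_finite_component E C" and "C \<subseteq> V"
proof -
  let ?R = "{(x, y). x \<in> V \<and> y \<in> V \<and> (x, y) \<in> E\<^sup>*}"
  have symstar: "sym (E\<^sup>*)" using E(2) by (rule sym_rtrancl)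
  have eq: "equiv V ?R"
    using symstar by (intro equivI) (auto simp: refl_on_def sym_def trans_def)
  obtain x0 where x0: "x0 \<in> V" "C = ?R `` {x0}"
    using C(1) by (auto simp: graph_components_def quotient_def)
  then have Cdef: "y \<in> C \<longleftrightarrow> y \<in> V \<and> (x0, y) \<in> E\<^sup>*" for y by auto
  show CV: "C \<subseteq> V" using Cdef by auto
  have conn: "(x, y) \<in> E\<^sup>*" if "x \<in> C" "y \<in> C" for x y
    using that Cdef symstar by (meson rtrancl_trans symD)
  show "locally_finite_component E C"
  proof
    show "countable C" using CV V by (rule countable_subset)
    show "sym E" by fact
    show "E `` {x} \<subseteq> C" if "x \<in> C" for x
      using that E(1) Cdef by (auto intro: rtrancl_into_rtrancl)
    show "finite (E `` {x})" for x by fact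
    show "E `` {x} \<noteq> {}" if x: "x \<in> C" for x
    proof -
      have "C \<noteq> {x}" using C(2) by (auto simp: is_singleton_def)
      then obtain y where "y \<in> C" "y \<noteq> x" using x by auto
      then have "(x, y) \<in> E\<^sup>+" using conn[OF x] by (auto simp: rtrancl_eq_or_trancl)
      then show ?thesis by (auto dest: tranclD)
    qed
    show "(x, y) \<in> E\<^sup>*" if "x \<in> C" "y \<in> C" for x y
      using that by (rule conn)
  qed
qed

section \<open>Radial integrals\<close>

text \<open>
  Polar coordinates for radial functions: the law of the distance to \<open>x\<close> under Lebesgue
  measure has the area of the sphere as its density. Both sides give a ball of radius \<open>r\<close> the mass
  \<open>unit_ball_vol n * r ^ n\<close>, and the half-lines generate the Borel sets.
\<close>

lemma distr_dist_lborel: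
  fixes x :: "'a::euclidean_space"
  assumes n: "n = DIM('a)"
  shows "distr lborel borel (dist x) =
    density lborel (\<lambda>r. ennreal (real n * unit_ball_vol (real n) * r ^ (n - 1)) * indicator {0..} r)"
    (is "?L = ?R")
proof (rule measure_eqI_generator_eq[where E = "range (\<lambda>r::real. {..r})" and \<Omega> = UNIV
      and A = "\<lambda>k. {..real k}"])
  have n0: "0 < n" using n by simp
  have m: "dist x \<in> borel_measurable borel" by measurable
  have L: "emeasure ?L {..r} = (if 0 \<le> r then ennreal (unit_ball_vol (real n) * r ^ n) else 0)" for r
  proof -
    have "dist x -` {..r} = cball x r" by (auto simp: cball_def)
    then show ?thesis
      using m by (auto simp: emeasure_distr emeasure_cball n cball_empty)
  qed
  have R: "emeasure ?R {..r} = (if 0 \<le> r then ennreal (unit_ball_vol (real n) * r ^ n) else 0)" for r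
  proof -
    have "emeasure ?R {..r} =
      (\<integral>\<^sup>+t. ennreal (real n * unit_ball_vol (real n) * t ^ (n - 1)) * indicator {0..r} t \<partial>lborel)"
      by (subst emeasure_density) (auto intro!: nn_integral_cong split: split_indicator)
    also have "\<dots> = (if 0 \<le> r then ennreal (unit_ball_vol (real n) * r ^ n) else 0)"
    proof (cases "0 \<le> r")
      case True
      have "(\<integral>\<^sup>+t. ennreal (real n * unit_ball_vol (real n) * t ^ (n - 1)) * indicator {0..r} t \<partial>lborel)
          = ennreal (unit_ball_vol (real n) * r ^ n - unit_ball_vol (real n) * 0 ^ n)"
        using True n0
        by (intro nn_integral_FTC_Icc) (auto intro!: derivative_eq_intros unit_ball_vol_nonneg)
      with True n0 show ?thesis by (simp add: zero_power)
    qed simp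
    finally show ?thesis .
  qed
  show "emeasure ?L X = emeasure ?R X" if "X \<in> range (\<lambda>r::real. {..r})" for X
    using that L R by auto
  show "emeasure ?L {..real k} \<noteq> \<infinity>" for k using L by simp
  show "Int_stable (range (\<lambda>r::real. {..r}))" by (auto simp: Int_stable_def)
  show "sets ?L = sigma_sets UNIV (range (\<lambda>r::real. {..r}))"
    by (simp add: borel_eq_atMost)
  show "sets ?R = sigma_sets UNIV (range (\<lambda>r::real. {..r}))"
    by (simp add: borel_eq_atMost)
  show "(\<Union>k. {..real k}) = (UNIV::real set)" using real_arch_simple by auto
qed auto

lemma nn_integral_radial_plane:
  fixes x :: "real^2"
  assumes [measurable]: "F \<in> borel_measurable borel"
  shows "(\<integral>\<^sup>+y. F (dist x y) \<partial>lborel) =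
    (\<integral>\<^sup>+r. ennreal (2 * pi * r) * indicator {0..} r * F r \<partial>lborel)"
proof -
  have "(\<integral>\<^sup>+y. F (dist x y) \<partial>lborel) = (\<integral>\<^sup>+r. F r \<partial>distr lborel borel (dist x))"
    by (subst nn_integral_distr) auto
  also have "\<dots> = (\<integral>\<^sup>+r. ennreal (2 * pi * r) * indicator {0..} r * F r \<partial>lborel)"
    by (subst distr_dist_lborel[of 2]) (auto simp: nn_integral_density unit_ball_vol_2 mult_ac)
  finally show ?thesis .
qed

section \<open>The logarithmic cutoff for the critical kernel in the plane\<close>

text \<open>
  The shift by 1 in both logarithms makes the function vanish at 0 and removes the singularity of the
  usual iterated logarithm without changing its growth.
\<close>

definition iter_log :: "real \<Rightarrow> real" where
  "iter_log r = ln (1 + ln (1 + r))"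

lemma iter_log_measurable [measurable]: "iter_log \<in> borel_measurable borel"
  unfolding iter_log_def[abs_def] by measurable

lemma iter_log_mono: "0 \<le> r \<Longrightarrow> r \<le> t \<Longrightarrow> iter_log r \<le> iter_log t"
proof -
  assume r: "0 \<le> r" "r \<le> t"
  then have "ln (1 + r) \<le> ln (1 + t)" "0 \<le> ln (1 + r)" by auto
  then show ?thesis by (simp add: iter_log_def)
qed

lemma iter_log_nonneg: "0 \<le> r \<Longrightarrow> 0 \<le> iter_log r"
  using iter_log_mono[of 0 r] by (simp add: iter_log_def)

lemma iter_log_le_imp_le:
  assumes "0 \<le> r" "iter_log r \<le> real n"
  shows "r \<le> exp (exp (real n) - 1) - 1"
proof -
  have "0 < 1 + ln (1 + r)" using assms by (simp add: add_pos_nonneg)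
  then have "1 + ln (1 + r) = exp (iter_log r)" by (simp add: iter_log_def)
  also have "\<dots> \<le> exp (real n)" using assms(2) by simp
  finally have "ln (1 + r) \<le> exp (real n) - 1" by simp
  then have "exp (ln (1 + r)) \<le> exp (exp (real n) - 1)" by simp
  then have "1 + r \<le> exp (exp (real n) - 1)"
    using assms(1) by simp
  then show ?thesis by simp
qed

text \<open>
  The increment of the inner logarithm is exact, and the outer logarithm lies below its tangent. The
  denominator is what makes the energy small: squared it gives two factors \<open>1 / ln\<close>, only one of which is
  used up by summing over the edge lengths.
\<close>

lemma iter_log_increment:
  assumes r: "0 \<le> r" and t: "0 \<le> t"
  shows "iter_log (r + t) - iter_log r \<le> ln (1 + t / (1 + r)) / (1 + ln (1 + r))"
proof -
  have L: "1 \<le> 1 + ln (1 + r)" "1 \<le> 1 + ln (1 + (r + t))" using r t by auto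
  have q: "(1 + (r + t)) / (1 + r) = 1 + t / (1 + r)"
    using r add_divide_distrib[of "1 + r" t "1 + r"] by (simp add: add.assoc)
  have "iter_log (r + t) - iter_log r = ln ((1 + ln (1 + (r + t))) / (1 + ln (1 + r)))"
    using L by (simp add: iter_log_def ln_div)
  also have "\<dots> \<le> (1 + ln (1 + (r + t))) / (1 + ln (1 + r)) - 1"
    using L by (intro ln_le_minus_one divide_pos_pos) auto
  also have "\<dots> = (ln (1 + (r + t)) - ln (1 + r)) / (1 + ln (1 + r))"
    using L by (simp add: diff_divide_distrib[symmetric] divide_diff_eq_iff)
  also have "ln (1 + (r + t)) - ln (1 + r) = ln (1 + t / (1 + r))"
    using r t by (subst q[symmetric], subst ln_div) auto
  finally show ?thesis .
qed

text \<open>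
  Up to the scale of \<open>iter_log\<close> this is the equilibrium potential for the critical kernel: the
  minimiser of \<open>\<integral> f'(r)\<^sup>2 * r * ln r dr\<close> has derivative proportional to \<open>1 / (r * ln r)\<close>.
\<close>

definition log_cutoff :: "nat \<Rightarrow> real^2 \<Rightarrow> real" where
  "log_cutoff n x = max 0 (1 - iter_log (norm x) / real n)"

lemma log_cutoff_measurable [measurable]: "log_cutoff n \<in> borel_measurable borel"
  unfolding log_cutoff_def[abs_def] by measurable

lemma log_cutoff_eq_0: "0 < n \<Longrightarrow> real n \<le> iter_log (norm x) \<Longrightarrow> log_cutoff n x = 0"
  by (simp add: log_cutoff_def field_simps)

lemma log_cutoff_bounds: "0 \<le> log_cutoff n x" "log_cutoff n x \<le> 1"
  by (auto simp: log_cutoff_def iter_log_nonneg)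

text \<open>
  The squared increment bound of \<open>iter_log_increment\<close>, for an edge of length \<open>r\<close> whose end
  closer to the origin has norm \<open>a - 1\<close>.
\<close>

definition log_profile :: "real \<Rightarrow> real \<Rightarrow> real" where
  "log_profile a r = (ln (1 + r / a))\<^sup>2 / (1 + ln a)\<^sup>2"

text \<open>
  Taking \<open>x\<close> to be the end closer to the origin has two effects: the increment is compared with the
  slope at \<open>x\<close>, where it is larger, and the edge contributes nothing unless \<open>x\<close> lies in the support.
\<close>

lemma log_cutoff_diff_sq_le:
  assumes n: "0 < n" and xy: "norm x \<le> norm y"
  shows "(log_cutoff n x - log_cutoff n y)\<^sup>2 \<le>
    indicator {x. iter_log (norm x) \<le> real n} x * (log_profile (1 + norm x) (dist x y) / (real n)\<^sup>2)"
proof (cases "iter_log (norm x) \<le> real n")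
  case False
  then have "log_cutoff n x = 0" "log_cutoff n y = 0"
    using n iter_log_mono[of "norm x" "norm y"] xy by (auto intro!: log_cutoff_eq_0)
  then show ?thesis using False by simp
next
  case True
  let ?d = "iter_log (norm y) - iter_log (norm x)"
  have d: "0 \<le> ?d" using iter_log_mono[of "norm x" "norm y"] xy by simp
  have "norm y \<le> norm x + dist x y" by (metis add.commute dist_norm norm_minus_commute norm_triangle_sub)
  then have "?d \<le> iter_log (norm x + dist x y) - iter_log (norm x)"
    using iter_log_mono[of "norm y"] by simp
  also have "\<dots> \<le> ln (1 + dist x y / (1 + norm x)) / (1 + ln (1 + norm x))"
    by (rule iter_log_increment) auto
  finally have "?d\<^sup>2 \<le> (ln (1 + dist x y / (1 + norm x)) / (1 + ln (1 + norm x)))\<^sup>2"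
    using d by (intro power_mono) auto
  then have dd: "?d\<^sup>2 \<le> log_profile (1 + norm x) (dist x y)"
    by (simp add: log_profile_def power_divide)
  have "\<bar>log_cutoff n x - log_cutoff n y\<bar> \<le> ?d / real n"
    using d n by (auto simp: log_cutoff_def max_def diff_divide_distrib divide_right_mono)
  then have "\<bar>log_cutoff n x - log_cutoff n y\<bar>\<^sup>2 \<le> (?d / real n)\<^sup>2"
    by (intro power_mono) auto
  also have "\<dots> \<le> log_profile (1 + norm x) (dist x y) / (real n)\<^sup>2"
    using dd n by (simp add: power_divide divide_right_mono)
  finally show ?thesis using True by simp
qed

lemma nn_integral_inverse_square_tail:
  assumes "0 \<le> a"
  shows "(\<integral>\<^sup>+r. ennreal (1 / (1 + r)\<^sup>2) * indicator {a..} r \<partial>lborel) = ennreal (1 / (1 + a))"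
proof -
  have "((\<lambda>r::real. - (1 / (1 + r))) \<longlongrightarrow> 0) at_top" by real_asymp
  then have "(\<integral>\<^sup>+r. ennreal (1 / (1 + r)\<^sup>2) * indicator {a..} r \<partial>lborel) = ennreal (0 - (- (1 / (1 + a))))"
    using assms
    by (intro nn_integral_FTC_atLeast[where F = "\<lambda>r. - (1 / (1 + r))"])
       (auto intro!: derivative_eq_intros simp: power2_eq_square)
  then show ?thesis by simp
qed

text \<open>
  The first bound is sharp for small \<open>u\<close>; the second, from \<open>1 + u \<le> (1 + sqrt u)\<^sup>2\<close>, is what makes the
  contribution of the very long edges integrable.
\<close>

lemma ln_one_plus_sq_le:
  assumes "0 \<le> (u::real)"
  shows "(ln (1 + u))\<^sup>2 \<le> u\<^sup>2" "(ln (1 + u))\<^sup>2 \<le> 4 * u"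
proof -
  have nn: "0 \<le> ln (1 + u)" using assms by simp
  have "ln (1 + u) \<le> u" using assms by (rule ln_add_one_self_le_self)
  with nn show "(ln (1 + u))\<^sup>2 \<le> u\<^sup>2" by (intro power_mono) auto
  have "1 + u \<le> (1 + sqrt u)\<^sup>2" using assms by (simp add: power2_eq_square algebra_simps)
  then have "ln (1 + u) \<le> ln ((1 + sqrt u)\<^sup>2)" using assms by (intro ln_mono) auto
  also have "\<dots> = 2 * ln (1 + sqrt u)" using assms by (simp add: ln_realpow)
  also have "\<dots> \<le> 2 * sqrt u" using assms by (simp add: ln_add_one_self_le_self)
  finally have "(ln (1 + u))\<^sup>2 \<le> (2 * sqrt u)\<^sup>2" using nn by (intro power_mono) auto
  then show "(ln (1 + u))\<^sup>2 \<le> 4 * u" using assms by (simp add: power_mult_distrib)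
qed

lemma one_plus_power_quotient:
  "0 \<le> (r::real) \<Longrightarrow> (1 + r) ^ k / (1 + r) ^ (k + m) = 1 / (1 + r) ^ m"
  by (simp add: power_add)

text \<open>
  Edges shorter than \<open>a\<close> see a function that is almost linear, and their contribution is of order
  \<open>1 / r\<close>, the source of the logarithm in the critical case; for longer edges the logarithmic growth
  of the increment leaves an integrable tail.
\<close>

lemma log_profile_radial_le:
  fixes a r :: real
  assumes a: "1 \<le> a" and r: "0 \<le> r"
  shows "r * ((ln (1 + r / a))\<^sup>2 / (1 + r) ^ 4) \<le>
    1 / a\<^sup>2 * (1 / (1 + r) * indicator {0..a} r) + 4 / a * (1 / (1 + r)\<^sup>2 * indicator {a..} r)"
proof -
  have ra: "0 \<le> r / a" using a r by (intro divide_nonneg_nonneg) auto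
  have p: "r ^ k \<le> (1 + r) ^ k" for k using r by (intro power_mono) auto
  show ?thesis
  proof (cases "r \<le> a")
    case True
    have "r * ((ln (1 + r / a))\<^sup>2 / (1 + r) ^ 4) \<le> r * ((r / a)\<^sup>2 / (1 + r) ^ 4)"
      using ln_one_plus_sq_le(1)[OF ra] r by (intro mult_left_mono divide_right_mono) auto
    also have "\<dots> = 1 / a\<^sup>2 * (r ^ 3 / (1 + r) ^ 4)"
      by (simp add: power2_eq_square power3_eq_cube)
    also have "\<dots> \<le> 1 / a\<^sup>2 * ((1 + r) ^ 3 / (1 + r) ^ 4)"
      using r p[of 3] by (intro mult_left_mono divide_right_mono) auto
    also have "(1 + r) ^ 3 / (1 + r) ^ 4 = 1 / (1 + r)"
      using one_plus_power_quotient[OF r, of 3 1] by simp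
    also have "1 / a\<^sup>2 * (1 / (1 + r)) \<le>
        1 / a\<^sup>2 * (1 / (1 + r) * indicator {0..a} r) + 4 / a * (1 / (1 + r)\<^sup>2 * indicator {a..} r)"
      using True r a by simp
    finally show ?thesis .
  next
    case False
    have "r * ((ln (1 + r / a))\<^sup>2 / (1 + r) ^ 4) \<le> r * (4 * (r / a) / (1 + r) ^ 4)"
      using ln_one_plus_sq_le(2)[OF ra] r by (intro mult_left_mono divide_right_mono) auto
    also have "\<dots> = 4 / a * (r ^ 2 / (1 + r) ^ 4)"
      by (simp add: power2_eq_square)
    also have "\<dots> \<le> 4 / a * ((1 + r) ^ 2 / (1 + r) ^ 4)"
      using r p[of 2] a by (intro mult_left_mono divide_right_mono) auto
    also have "(1 + r) ^ 2 / (1 + r) ^ 4 = 1 / (1 + r)\<^sup>2"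
      using one_plus_power_quotient[OF r, of 2 2] by simp
    finally show ?thesis using False by simp
  qed
qed

text \<open>
  Up to a constant, the short edges contribute at most \<open>ln (1 + a) / a\<^sup>2\<close> and the long ones at most
  \<open>4 / a\<^sup>2\<close>, so the weight
  \<open>1 / (1 + ln a)\<^sup>2\<close> of \<open>log_profile\<close> loses one power of the logarithm.
\<close>

lemma nn_integral_log_profile_le:
  assumes a: "1 \<le> a"
  shows "(\<integral>\<^sup>+r. ennreal (2 * pi * r) * indicator {0..} r * ennreal (log_profile a r / (1 + r) ^ 4) \<partial>lborel)
    \<le> ennreal (10 * pi / (a\<^sup>2 * (1 + ln a)))"
proof -
  have la: "0 \<le> ln a" using a by simp
  define c where "c = 2 * pi / (1 + ln a)\<^sup>2"
  have c: "0 \<le> c" by (simp add: c_def)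
  have "(\<integral>\<^sup>+r. ennreal (2 * pi * r) * indicator {0..} r * ennreal (log_profile a r / (1 + r) ^ 4) \<partial>lborel) \<le>
    (\<integral>\<^sup>+r. ennreal (c / a\<^sup>2) * (ennreal (1 / (1 + r)) * indicator {0..a} r) +
          ennreal (c * 4 / a) * (ennreal (1 / (1 + r)\<^sup>2) * indicator {a..} r) \<partial>lborel)"
  proof (rule nn_integral_mono)
    fix r :: real
    show "ennreal (2 * pi * r) * indicator {0..} r * ennreal (log_profile a r / (1 + r) ^ 4) \<le>
      ennreal (c / a\<^sup>2) * (ennreal (1 / (1 + r)) * indicator {0..a} r) +
          ennreal (c * 4 / a) * (ennreal (1 / (1 + r)\<^sup>2) * indicator {a..} r)"
    proof (cases "0 \<le> r")
      case True
      have "2 * pi * r * (log_profile a r / (1 + r) ^ 4) = c * (r * ((ln (1 + r / a))\<^sup>2 / (1 + r) ^ 4))"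
        by (simp add: c_def log_profile_def)
      also have "\<dots> \<le> c * (1 / a\<^sup>2 * (1 / (1 + r) * indicator {0..a} r) +
          4 / a * (1 / (1 + r)\<^sup>2 * indicator {a..} r))"
        using log_profile_radial_le[OF a True] c by (rule mult_left_mono)
      also have "\<dots> = c / a\<^sup>2 * (1 / (1 + r) * indicator {0..a} r) +
          c * 4 / a * (1 / (1 + r)\<^sup>2 * indicator {a..} r)" by (simp add: distrib_left)
      finally have "ennreal (2 * pi * r * (log_profile a r / (1 + r) ^ 4)) \<le>
        ennreal (c / a\<^sup>2 * (1 / (1 + r) * indicator {0..a} r) +
          c * 4 / a * (1 / (1 + r)\<^sup>2 * indicator {a..} r))" by (rule ennreal_leI)
      also have "\<dots> = ennreal (c / a\<^sup>2) * (ennreal (1 / (1 + r)) * indicator {0..a} r) +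
          ennreal (c * 4 / a) * (ennreal (1 / (1 + r)\<^sup>2) * indicator {a..} r)"
        using True a c
        by (subst ennreal_plus) (auto simp: ennreal_mult[symmetric] split: split_indicator)
      finally show ?thesis using True by (simp add: ennreal_mult''[symmetric] log_profile_def)
    qed simp
  qed
  also have "\<dots> = ennreal (c / a\<^sup>2) * (\<integral>\<^sup>+r. ennreal (1 / (1 + r)) * indicator {0..a} r \<partial>lborel) +
      ennreal (c * 4 / a) * (\<integral>\<^sup>+r. ennreal (1 / (1 + r)\<^sup>2) * indicator {a..} r \<partial>lborel)"
    by (subst nn_integral_add) (auto simp: nn_integral_cmult)
  also have "(\<integral>\<^sup>+r. ennreal (1 / (1 + r)) * indicator {0..a} r \<partial>lborel) = ennreal (ln (1 + a) - ln (1 + 0))"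
    using a by (intro nn_integral_FTC_Icc) (auto intro!: derivative_eq_intros)
  also have "(\<integral>\<^sup>+r. ennreal (1 / (1 + r)\<^sup>2) * indicator {a..} r \<partial>lborel) = ennreal (1 / (1 + a))"
    using a by (intro nn_integral_inverse_square_tail) auto
  also have "ennreal (c / a\<^sup>2) * ennreal (ln (1 + a) - ln (1 + 0)) + ennreal (c * 4 / a) * ennreal (1 / (1 + a)) =
      ennreal (c / a\<^sup>2 * ln (1 + a) + c * 4 / a * (1 / (1 + a)))"
    using a c by (simp add: ennreal_mult'[symmetric] flip: ennreal_plus)
  also have "\<dots> \<le> ennreal (10 * pi / (a\<^sup>2 * (1 + ln a)))"
  proof (rule ennreal_leI)
    have "ln (1 + a) \<le> ln (2 * a)" using a by simp
    also have "\<dots> = ln 2 + ln a" using a by (simp add: ln_mult)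
    also have "\<dots> \<le> 1 + ln a" using ln_le_minus_one[of 2] by simp
    finally have "c / a\<^sup>2 * ln (1 + a) \<le> c / a\<^sup>2 * (1 + ln a)" using c by (intro mult_left_mono) auto
    moreover have "c * 4 / a * (1 / (1 + a)) \<le> c * 4 / a * ((1 + ln a) / a)"
      using a c la by (intro mult_left_mono frac_le) auto
    moreover have "c * 4 / a * ((1 + ln a) / a) = 4 * (c / a\<^sup>2 * (1 + ln a))"
      by (simp add: power2_eq_square)
    moreover have "5 * (c * (1 + ln a)) / a\<^sup>2 = 5 * (c / a\<^sup>2 * (1 + ln a))" by simp
    ultimately have "c / a\<^sup>2 * ln (1 + a) + c * 4 / a * (1 / (1 + a)) \<le> 5 * (c * (1 + ln a)) / a\<^sup>2"
      by linarith
    also have "c * (1 + ln a) = 2 * pi / (1 + ln a)" using la by (simp add: c_def power2_eq_square)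
    finally show "c / a\<^sup>2 * ln (1 + a) + c * 4 / a * (1 / (1 + a)) \<le> 10 * pi / (a\<^sup>2 * (1 + ln a))"
      by (simp add: mult.commute)
  qed
  finally show ?thesis .
qed

text \<open>
  In polar coordinates the density is at most \<open>2 * pi\<close> times the derivative of \<open>iter_log\<close>, so the integral over a disc
  is at most \<open>2 * pi\<close> times the value of \<open>iter_log\<close> at the radius.
\<close>

lemma nn_integral_iter_log_density_le:
  assumes n: "0 < n"
  shows "(\<integral>\<^sup>+x. indicator {x::real^2. iter_log (norm x) \<le> real n} x *
      ennreal (1 / ((1 + norm x)\<^sup>2 * (1 + ln (1 + norm x)))) \<partial>lborel) \<le> ennreal (2 * pi * real n)"
proof -
  \<comment> \<open>\<open>R\<close> is the solution of \<open>iter_log R = n\<close>, the radius of the support of the cutoff.\<close>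
  define R where "R = exp (exp (real n) - 1) - 1"
  have R: "0 \<le> R" "iter_log R = real n" by (auto simp: R_def iter_log_def)
  define F where "F r = indicator {0..R} r * ennreal (1 / ((1 + r)\<^sup>2 * (1 + ln (1 + r))))" for r :: real
  have [measurable]: "F \<in> borel_measurable borel" unfolding F_def[abs_def] by measurable
  have "(\<integral>\<^sup>+x. indicator {x::real^2. iter_log (norm x) \<le> real n} x *
      ennreal (1 / ((1 + norm x)\<^sup>2 * (1 + ln (1 + norm x)))) \<partial>lborel) \<le> (\<integral>\<^sup>+x. F (dist (0::real^2) x) \<partial>lborel)"
  proof (rule nn_integral_mono)
    fix x :: "real^2"
    have "norm x \<le> R" if "iter_log (norm x) \<le> real n"
      using iter_log_le_imp_le[of "norm x" n] that by (simp add: R_def)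
    then show "indicator {x::real^2. iter_log (norm x) \<le> real n} x *
      ennreal (1 / ((1 + norm x)\<^sup>2 * (1 + ln (1 + norm x)))) \<le> F (dist 0 x)"
      by (auto simp: F_def indicator_def)
  qed
  also have "\<dots> = (\<integral>\<^sup>+r. ennreal (2 * pi * r) * indicator {0..} r * F r \<partial>lborel)"
    by (rule nn_integral_radial_plane) measurable
  also have "\<dots> \<le> (\<integral>\<^sup>+r. ennreal (2 * pi * (1 / (1 + r) / (1 + ln (1 + r)))) * indicator {0..R} r \<partial>lborel)"
  proof (rule nn_integral_mono)
    fix r :: real
    have "2 * pi * r * (1 / ((1 + r)\<^sup>2 * (1 + ln (1 + r)))) \<le> 2 * pi * (1 / (1 + r) / (1 + ln (1 + r)))"
      if r: "0 \<le> r"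
    proof -
      have l: "0 < 1 + ln (1 + r)" using r by (simp add: add_pos_nonneg)
      have "r * (1 / ((1 + r)\<^sup>2 * (1 + ln (1 + r)))) \<le> (1 + r) * (1 / ((1 + r)\<^sup>2 * (1 + ln (1 + r))))"
        using r l by (intro mult_right_mono) auto
      also have "\<dots> = 1 / (1 + r) / (1 + ln (1 + r))"
        using r by (simp add: power2_eq_square)
      finally show ?thesis by (simp only: mult.assoc) (intro mult_left_mono, auto)
    qed
    then show "ennreal (2 * pi * r) * indicator {0..} r * F r \<le>
        ennreal (2 * pi * (1 / (1 + r) / (1 + ln (1 + r)))) * indicator {0..R} r"
      by (auto simp: F_def ennreal_mult'[symmetric] intro!: ennreal_leI split: split_indicator)
  qed
  also have "\<dots> = ennreal (2 * pi * iter_log R - 2 * pi * iter_log 0)"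
    unfolding iter_log_def
  proof (rule nn_integral_FTC_Icc)
    fix r assume r: "r \<in> {0..R}"
    then have l: "0 < 1 + ln (1 + r)" by (simp add: add_pos_nonneg)
    show "((\<lambda>r. 2 * pi * ln (1 + ln (1 + r))) has_real_derivative 2 * pi * (1 / (1 + r) / (1 + ln (1 + r))))
        (at r)"
      using r l by (auto intro!: derivative_eq_intros)
    show "0 \<le> 2 * pi * (1 / (1 + r) / (1 + ln (1 + r)))" using r l by simp
  qed (use R in auto)
  finally show ?thesis using R by (simp add: iter_log_def)
qed

lemma nn_integral_pow4_decay:
  fixes x :: "real^2"
  shows "(\<integral>\<^sup>+y. ennreal (1 / (1 + dist x y) ^ 4) \<partial>lborel) \<le> ennreal (2 * pi)"
proof -
  have "(\<integral>\<^sup>+y. ennreal (1 / (1 + dist x y) ^ 4) \<partial>lborel) =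
      (\<integral>\<^sup>+r. ennreal (2 * pi * r) * indicator {0..} r * ennreal (1 / (1 + r) ^ 4) \<partial>lborel)"
    by (rule nn_integral_radial_plane) measurable
  also have "\<dots> \<le> (\<integral>\<^sup>+r. ennreal (2 * pi) * (ennreal (1 / (1 + r)\<^sup>2) * indicator {0..} r) \<partial>lborel)"
  proof (rule nn_integral_mono)
    fix r :: real
    have "r * (1 / (1 + r) ^ 4) \<le> 1 / (1 + r)\<^sup>2" if r: "0 \<le> r"
    proof -
      have "r * (1 / (1 + r) ^ 4) \<le> (1 + r)\<^sup>2 * (1 / (1 + r) ^ 4)"
        using r by (intro mult_right_mono) (auto simp: power2_eq_square algebra_simps)
      also have "\<dots> = 1 / (1 + r)\<^sup>2"
        using one_plus_power_quotient[OF r, of 2 2] by simp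
      finally show ?thesis .
    qed
    then have "2 * pi * r * (1 / (1 + r) ^ 4) \<le> 2 * pi * (1 / (1 + r)\<^sup>2)" if "0 \<le> r"
      using that by (simp only: mult.assoc) (intro mult_left_mono, auto)
    then show "ennreal (2 * pi * r) * indicator {0..} r * ennreal (1 / (1 + r) ^ 4) \<le>
        ennreal (2 * pi) * (ennreal (1 / (1 + r)\<^sup>2) * indicator {0..} r)"
      by (auto simp: ennreal_mult'[symmetric] intro!: ennreal_leI split: split_indicator)
  qed
  also have "\<dots> = ennreal (2 * pi)"
    by (simp add: nn_integral_cmult nn_integral_inverse_square_tail)
  finally show ?thesis .
qed

text \<open>
  The heart of the matter: for the critical decay exponent 4 of the kernel the plane still admits cutoffs
  of vanishing energy. The factor \<open>1 / n\<^sup>2\<close> comes from the slope of the cutoff and the factor \<open>n\<close> from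
  \<open>nn_integral_iter_log_density_le\<close>.
\<close>

lemma nn_integral_log_cutoff_energy_le:
  assumes n: "0 < n"
  shows "(\<integral>\<^sup>+x. \<integral>\<^sup>+y. ennreal ((log_cutoff n x - log_cutoff n y)\<^sup>2 / (1 + dist x y) ^ 4) \<partial>lborel \<partial>lborel)
    \<le> ennreal (40 * pi\<^sup>2 / real n)"
proof -
  define k where "k x y = ennreal ((log_cutoff n x - log_cutoff n y)\<^sup>2 / (1 + dist x y) ^ 4)" for x y
  \<comment> \<open>By symmetry it suffices to integrate over the pairs whose first point is closer to the origin.\<close>
  define H where "H x y = k x y * indicator {(x, y). norm x \<le> norm y} (x, y)" for x y
  define S where "S = {x::real^2. iter_log (norm x) \<le> real n}"
  have [measurable]: "S \<in> sets borel" unfolding S_def by measurable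
  have [measurable]: "(\<lambda>(x, y). k x y) \<in> borel_measurable (borel \<Otimes>\<^sub>M borel)"
    unfolding k_def by measurable
  have [measurable]: "{(x::real^2, y::real^2). norm x \<le> norm y} \<in> sets (borel \<Otimes>\<^sub>M borel)"
    unfolding borel_prod case_prod_beta by (intro borel_closed closed_Collect_le continuous_intros)
  have Hm[measurable]: "(\<lambda>(x, y). H x y) \<in> borel_measurable (borel \<Otimes>\<^sub>M borel)"
    unfolding H_def by measurable
  have sym: "k x y = k y x" for x y
    by (simp add: k_def dist_commute power2_commute)
  have inner: "(\<integral>\<^sup>+y. H x y \<partial>lborel) \<le> ennreal (10 * pi / (real n)\<^sup>2) *
      (indicator S x * ennreal (1 / ((1 + norm x)\<^sup>2 * (1 + ln (1 + norm x)))))" for x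
  proof -
    let ?a = "1 + norm x"
    let ?F = "\<lambda>r. ennreal (log_profile ?a r / (1 + r) ^ 4)"
    have [measurable]: "?F \<in> borel_measurable borel" unfolding log_profile_def by measurable
    have "(\<integral>\<^sup>+y. H x y \<partial>lborel) \<le> (\<integral>\<^sup>+y. ennreal (1 / (real n)\<^sup>2) * indicator S x * ?F (dist x y) \<partial>lborel)"
    proof (rule nn_integral_mono)
      fix y
      have "H x y \<le> ennreal (1 / (real n)\<^sup>2 * indicator S x * (log_profile ?a (dist x y) / (1 + dist x y) ^ 4))"
      proof (cases "norm x \<le> norm y")
        case True
        have "(log_cutoff n x - log_cutoff n y)\<^sup>2 / (1 + dist x y) ^ 4 \<le>
            indicator S x * (log_profile ?a (dist x y) / (real n)\<^sup>2) / (1 + dist x y) ^ 4"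
          unfolding S_def by (intro divide_right_mono log_cutoff_diff_sq_le n True) auto
        with True show ?thesis unfolding H_def k_def by (auto intro!: ennreal_leI simp: mult_ac)
      qed (simp add: H_def)
      also have "\<dots> = ennreal (1 / (real n)\<^sup>2) * indicator S x * ?F (dist x y)"
        by (auto simp: ennreal_mult'[symmetric] split: split_indicator)
      finally show "H x y \<le> ennreal (1 / (real n)\<^sup>2) * indicator S x * ?F (dist x y)" .
    qed
    also have "\<dots> = ennreal (1 / (real n)\<^sup>2) * indicator S x * (\<integral>\<^sup>+y. ?F (dist x y) \<partial>lborel)"
      by (rule nn_integral_cmult) measurable
    also have "(\<integral>\<^sup>+y. ?F (dist x y) \<partial>lborel) =
        (\<integral>\<^sup>+r. ennreal (2 * pi * r) * indicator {0..} r * ?F r \<partial>lborel)"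
      by (rule nn_integral_radial_plane) measurable
    also have "ennreal (1 / (real n)\<^sup>2) * indicator S x * \<dots> \<le>
        ennreal (1 / (real n)\<^sup>2) * indicator S x * ennreal (10 * pi / (?a\<^sup>2 * (1 + ln ?a)))"
      by (intro mult_left_mono nn_integral_log_profile_le) auto
    also have "\<dots> = ennreal (10 * pi / (real n)\<^sup>2) * (indicator S x * ennreal (1 / (?a\<^sup>2 * (1 + ln ?a))))"
      by (auto simp: ennreal_mult'[symmetric] split: split_indicator)
    finally show ?thesis .
  qed
  have half: "(\<integral>\<^sup>+x. \<integral>\<^sup>+y. H x y \<partial>lborel \<partial>lborel) \<le> ennreal (20 * pi\<^sup>2 / real n)"
  proof -
    have "(\<integral>\<^sup>+x. \<integral>\<^sup>+y. H x y \<partial>lborel \<partial>lborel) \<le> (\<integral>\<^sup>+x. ennreal (10 * pi / (real n)\<^sup>2) *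
      (indicator S x * ennreal (1 / ((1 + norm x)\<^sup>2 * (1 + ln (1 + norm x))))) \<partial>lborel)"
      by (rule nn_integral_mono) (rule inner)
    also have "\<dots> = ennreal (10 * pi / (real n)\<^sup>2) *
      (\<integral>\<^sup>+x. indicator S x * ennreal (1 / ((1 + norm x)\<^sup>2 * (1 + ln (1 + norm x)))) \<partial>lborel)"
      by (rule nn_integral_cmult) measurable
    also have "\<dots> \<le> ennreal (10 * pi / (real n)\<^sup>2) * ennreal (2 * pi * real n)"
      unfolding S_def by (intro mult_left_mono nn_integral_iter_log_density_le n) auto
    also have "\<dots> = ennreal (20 * pi\<^sup>2 / real n)"
      using n by (simp add: ennreal_mult'[symmetric] power2_eq_square field_simps)
    finally show ?thesis .
  qed
  have "(\<integral>\<^sup>+x. \<integral>\<^sup>+y. k x y \<partial>lborel \<partial>lborel) \<le> (\<integral>\<^sup>+x. \<integral>\<^sup>+y. H x y + H y x \<partial>lborel \<partial>lborel)"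
    using sym by (intro nn_integral_mono) (auto simp: H_def indicator_def)
  also have "\<dots> = (\<integral>\<^sup>+x. (\<integral>\<^sup>+y. H x y \<partial>lborel) + (\<integral>\<^sup>+y. H y x \<partial>lborel) \<partial>lborel)"
    by (intro nn_integral_cong nn_integral_add) measurable
  also have "\<dots> = (\<integral>\<^sup>+x. \<integral>\<^sup>+y. H x y \<partial>lborel \<partial>lborel) + (\<integral>\<^sup>+x. \<integral>\<^sup>+y. H y x \<partial>lborel \<partial>lborel)"
    by (rule nn_integral_add) measurable
  also have "(\<integral>\<^sup>+x. \<integral>\<^sup>+y. H y x \<partial>lborel \<partial>lborel) = (\<integral>\<^sup>+x. \<integral>\<^sup>+y. H x y \<partial>lborel \<partial>lborel)"
    using Hm by (intro lborel_pair.Fubini'[symmetric]) (simp cong: measurable_cong_sets)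
  also have "(\<integral>\<^sup>+x. \<integral>\<^sup>+y. H x y \<partial>lborel \<partial>lborel) + (\<integral>\<^sup>+x. \<integral>\<^sup>+y. H x y \<partial>lborel \<partial>lborel) \<le>
      ennreal (20 * pi\<^sup>2 / real n) + ennreal (20 * pi\<^sup>2 / real n)"
    by (intro add_mono half)
  also have "\<dots> = ennreal (40 * pi\<^sup>2 / real n)" by (simp flip: ennreal_plus)
  finally show ?thesis unfolding k_def .
qed

text \<open>
  Near the origin the bound \<open>g \<le> 1\<close> is used, away from it the decay; the 1-norm dominates the Euclidean
  norm, so the decay in the former is the stronger assumption. The factor \<open>16 = 2 ^ 4\<close> is the price
  for replacing \<open>norm x\<close> by \<open>1 + norm x\<close>.
\<close>

lemma polynomial_decay_bound:
  fixes g :: "real^'d \<Rightarrow> real"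
  assumes g1: "\<And>x. g x \<le> 1" and s: "4 \<le> s"
    and bdd: "bdd_above ((\<lambda>x. g x / norm1 x powr (- s)) ` (UNIV - {0}))"
  obtains K where "0 < K" "\<And>x. g x \<le> K / (1 + norm x) ^ 4"
proof -
  obtain K0 where K0: "\<And>x. x \<noteq> 0 \<Longrightarrow> g x / norm1 x powr (- s) \<le> K0"
    using bdd by (auto simp: bdd_above_def)
  define K1 where "K1 = max 1 K0"
  have K1: "1 \<le> K1" "K0 \<le> K1" by (auto simp: K1_def)
  have pos: "0 < (1 + norm x) ^ 4" for x :: "real^'d"
    by (intro zero_less_power add_pos_nonneg) auto
  have "g x \<le> 16 * K1 / (1 + norm x) ^ 4" for x
  proof (cases "norm x \<le> 1")
    case True
    have "(1 + norm x) ^ 4 \<le> 2 ^ 4" using True by (intro power_mono) auto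
    then have "1 * (1 + norm x) ^ 4 \<le> 16 * K1" using K1 by simp
    then have "1 \<le> 16 * K1 / (1 + norm x) ^ 4"
      by (simp add: pos_le_divide_eq[OF pos])
    with g1[of x] show ?thesis by linarith
  next
    case False
    then have n: "1 < norm x" by simp
    have n1: "norm x \<le> norm1 x"
      unfolding norm1_def by (rule norm_le_l1_cart)
    have "g x \<le> K0 * norm1 x powr (- s)"
    proof -
      have "x \<noteq> 0" "0 < norm1 x powr (- s)" using n n1 by auto
      then show ?thesis using K0[of x] by (simp add: pos_divide_le_eq)
    qed
    also have "\<dots> \<le> K1 * norm1 x powr (- 4)"
      using K1 s n n1 by (intro mult_mono powr_mono) auto
    also have "norm1 x powr (- 4) = 1 / norm1 x ^ 4"
      using n n1 by (simp add: powr_minus inverse_eq_divide)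
    also have "K1 * (1 / norm1 x ^ 4) \<le> K1 * (1 / norm x ^ 4)"
    proof -
      have "0 < norm x" "0 < norm1 x" using n n1 by linarith+
      then have "0 < norm1 x ^ 4 * norm x ^ 4" by (intro mult_pos_pos zero_less_power)
      then show ?thesis
        using K1 n n1 by (intro mult_left_mono divide_left_mono power_mono) auto
    qed
    also have "\<dots> \<le> K1 * (16 / (1 + norm x) ^ 4)"
    proof (intro mult_left_mono)
      have "(1 + norm x) ^ 4 \<le> (2 * norm x) ^ 4" using n by (intro power_mono) auto
      also have "\<dots> = 16 * norm x ^ 4" by (simp add: power_mult_distrib)
      finally have le: "(1 + norm x) ^ 4 \<le> 16 * norm x ^ 4" .
      have "0 < norm x" using n by linarith
      then have "0 < 16 * norm x ^ 4 * (1 + norm x) ^ 4" using pos[of x] by (intro mult_pos_pos) auto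
      with le have "16 / (16 * norm x ^ 4) \<le> 16 / (1 + norm x) ^ 4"
        by (intro divide_left_mono) auto
      then show "1 / norm x ^ 4 \<le> 16 / (1 + norm x) ^ 4" by simp
    qed (use K1 in auto)
    finally show ?thesis by (simp add: mult.commute)
  qed
  moreover have "0 < 16 * K1" using K1 by simp
  ultimately show thesis by (rule that[rotated])
qed

section \<open>The second factorial moment measure of a Poisson process\<close>

lemma poisson_mean_sums:
  fixes l :: real
  shows "(\<lambda>k. real k * (exp (- l) * l ^ k / fact k)) sums l"
proof -
  have "(\<lambda>k. l ^ k / fact k) sums exp l"
    using exp_converges[of l] by (simp add: field_simps scaleR_conv_of_real)
  from sums_mult[OF this, of "exp (- l) * l"]
  moreover have "exp (- l) * l * exp l = l" by (simp add: exp_minus)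
  ultimately have "(\<lambda>k. exp (- l) * l * (l ^ k / fact k)) sums l" by simp
  also have "(\<lambda>k. exp (- l) * l * (l ^ k / fact k)) =
      (\<lambda>k. real (Suc k) * (exp (- l) * l ^ Suc k / fact (Suc k)))"
    by (auto simp: fun_eq_iff fact_Suc simp del: of_nat_Suc mult_Suc)
  finally show ?thesis by (subst (asm) sums_Suc_iff) simp
qed

lemma poisson_factorial_moment_sums:
  fixes l :: real
  shows "(\<lambda>k. real (k * (k - 1)) * (exp (- l) * l ^ k / fact k)) sums l\<^sup>2"
proof -
  from sums_mult[OF poisson_mean_sums[of l], of l]
  have "(\<lambda>k. l * (real k * (exp (- l) * l ^ k / fact k))) sums l\<^sup>2"
    by (simp add: power2_eq_square)
  also have "(\<lambda>k. l * (real k * (exp (- l) * l ^ k / fact k))) =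
      (\<lambda>k. real (Suc k * (Suc k - 1)) * (exp (- l) * l ^ Suc k / fact (Suc k)))"
    by (auto simp: fun_eq_iff fact_Suc simp del: of_nat_Suc mult_Suc)
  finally show ?thesis by (subst (asm) sums_Suc_iff) simp
qed

context prob_space
begin

lemma nn_integral_nat_valued:
  assumes K: "K \<in> M \<rightarrow>\<^sub>M count_space (UNIV :: nat set)"
    and s: "(\<lambda>k. real (f k) * prob {w \<in> space M. K w = k}) sums c"
  shows "(\<integral>\<^sup>+w. ennreal (real (f (K w))) \<partial>M) = ennreal c"
proof -
  note K[measurable]
  have "(\<integral>\<^sup>+w. ennreal (real (f (K w))) \<partial>M) =
      (\<integral>\<^sup>+w. (\<integral>\<^sup>+k. ennreal (real (f k)) * indicator {w \<in> space M. K w = k} w \<partial>count_space UNIV) \<partial>M)"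
  proof (rule nn_integral_cong)
    fix w assume w: "w \<in> space M"
    have "(\<integral>\<^sup>+k. ennreal (real (f k)) * indicator {w \<in> space M. K w = k} w \<partial>count_space UNIV) =
        (\<integral>\<^sup>+k. ennreal (real (f k)) * indicator {K w} k \<partial>count_space UNIV)"
      using w by (intro nn_integral_cong) (auto simp: indicator_def)
    then show "ennreal (real (f (K w))) =
        (\<integral>\<^sup>+k. ennreal (real (f k)) * indicator {w \<in> space M. K w = k} w \<partial>count_space UNIV)"
      by simp
  qed
  also have "\<dots> = (\<integral>\<^sup>+k. (\<integral>\<^sup>+w. ennreal (real (f k)) * indicator {w \<in> space M. K w = k} w \<partial>M) \<partial>count_space UNIV)"
    by (rule nn_integral_count_space_nn_integral) auto
  also have "\<dots> = (\<integral>\<^sup>+k. ennreal (real (f k) * prob {w \<in> space M. K w = k}) \<partial>count_space UNIV)"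
    by (intro nn_integral_cong) (simp add: nn_integral_cmult_indicator emeasure_eq_measure ennreal_mult')
  also have "\<dots> = (\<Sum>k. ennreal (real (f k) * prob {w \<in> space M. K w = k}))"
    by (rule nn_integral_count_space_nat)
  also have "\<dots> = ennreal c"
    using s by (intro suminf_ennreal_eq) auto
  finally show ?thesis .
qed

end

context poisson_point_process
begin

lemma mean_nonneg:
  fixes B :: "'b set"
  assumes "bounded B" "B \<in> sets borel"
  shows "0 \<le> \<rho> * measure lborel B"
proof -
  have "0 \<le> exp (- (\<rho> * measure lborel B)) * (\<rho> * measure lborel B) ^ 1 / fact 1"
    unfolding poisson_counts[OF assms, of 1, symmetric] by simp
  then show ?thesis by (simp add: zero_le_mult_iff)
qed

lemma count_measurable:
  assumes "bounded B" "B \<in> sets borel"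
  shows "(\<lambda>w. card (P w \<inter> B)) \<in> M \<rightarrow>\<^sub>M count_space UNIV"
proof -
  have "indep_vars (\<lambda>_. count_space UNIV) (\<lambda>B w. card (P w \<inter> B)) {B}"
    using assms by (intro indep_counts) (auto simp: disjoint_def)
  then show ?thesis by (auto simp: indep_vars_def)
qed

lemma count_mean:
  assumes "bounded B" "B \<in> sets borel"
  shows "(\<integral>\<^sup>+w. ennreal (real (card (P w \<inter> B))) \<partial>M) = ennreal (\<rho> * measure lborel B)"
  using nn_integral_nat_valued[OF count_measurable[OF assms], of "\<lambda>k. k"]
    poisson_mean_sums[of "\<rho> * measure lborel B"]
  by (simp add: poisson_counts[OF assms])

lemma count_factorial_moment:
  assumes "bounded B" "B \<in> sets borel"
  shows "(\<integral>\<^sup>+w. ennreal (real (card (P w \<inter> B) * (card (P w \<inter> B) - 1))) \<partial>M) =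
    ennreal ((\<rho> * measure lborel B)\<^sup>2)"
  using nn_integral_nat_valued[OF count_measurable[OF assms], of "\<lambda>k. k * (k - 1)"]
    poisson_factorial_moment_sums[of "\<rho> * measure lborel B"]
  by (simp add: poisson_counts[OF assms])

lemma count_product_moment:
  assumes A: "bounded A" "A \<in> sets borel" and B: "bounded B" "B \<in> sets borel"
    and disj: "A \<inter> B = {}"
  shows "(\<integral>\<^sup>+w. ennreal (real (card (P w \<inter> A) * card (P w \<inter> B))) \<partial>M) =
    ennreal (\<rho> * measure lborel A) * ennreal (\<rho> * measure lborel B)"
proof (cases "A = B")
  case True
  with disj have "A = {}" "B = {}" by auto
  then show ?thesis by simp
next
  case False
  have "indep_vars (\<lambda>_. count_space UNIV) (\<lambda>B w. card (P w \<inter> B)) {A, B}"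
    using A B disj by (intro indep_counts) (auto simp: disjoint_def)
  then have "indep_vars (\<lambda>_. borel) (\<lambda>B w. ennreal (real (card (P w \<inter> B)))) {A, B}"
    by (rule indep_vars_compose2[where Y = "\<lambda>_ k. ennreal (real k)"]) auto
  then have "(\<integral>\<^sup>+w. (\<Prod>C\<in>{A, B}. ennreal (real (card (P w \<inter> C)))) \<partial>M) =
      (\<Prod>C\<in>{A, B}. \<integral>\<^sup>+w. ennreal (real (card (P w \<inter> C))) \<partial>M)"
    by (intro indep_vars_nn_integral) auto
  then show ?thesis
    using False by (simp add: count_mean A B ennreal_mult')
qed

end

text \<open>
  The off-diagonal pairs of indices stand for the ordered pairs of distinct points.
\<close>

lemma nn_integral_off_diagonal_pairs:
  assumes I: "finite I" and J: "finite J"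
  shows "(\<integral>\<^sup>+(i, j). indicator I i * indicator J j \<partial>count_space (- Id)) =
    ennreal (real (card ((I \<times> J) - Id)))"
proof -
  have "(\<integral>\<^sup>+(i, j). indicator I i * indicator J j \<partial>count_space (- Id)) =
      (\<integral>\<^sup>+z. indicator ((I \<times> J) - Id) z \<partial>count_space (- Id))"
    by (intro nn_integral_cong) (auto simp: indicator_def)
  also have "\<dots> = emeasure (count_space (- Id)) ((I \<times> J) - Id)"
    by (rule nn_integral_indicator) auto
  also have "\<dots> = ennreal (real (card ((I \<times> J) - Id)))"
    using I J by (subst emeasure_count_space_finite) (auto simp: ennreal_of_nat_eq_real_of_nat)
  finally show ?thesis .
qed

context random_connection_model
begin

abbreviation index_pairs :: "(nat \<times> nat) set" where
  "index_pairs \<equiv> - Id"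

lemma countable_index_pairs: "countable index_pairs"
  by (rule countableI_type)

text \<open>
  The second factorial moment measure of the point process: the expected number of ordered pairs of
  distinct points in a given subset of the square of the space. Realising it as the image of a
  product measure makes its integrals a case of the transformation formula.
\<close>

definition factorial_moment_measure :: "('b \<times> 'b) measure" where
  "factorial_moment_measure =
     distr (count_space index_pairs \<Otimes>\<^sub>M M) (borel \<Otimes>\<^sub>M borel) (\<lambda>((i, j), w). (X i w, X j w))"

lemma pair_points_measurable:
  "(\<lambda>((i, j), w). (X i w, X j w)) \<in> count_space index_pairs \<Otimes>\<^sub>M M \<rightarrow>\<^sub>M borel \<Otimes>\<^sub>M borel"
  using points_measurable countable_index_pairs
  by (intro measurable_pair_measure_countable1) (auto simp: case_prod_beta)

lemma nn_integral_factorial_moment_measure: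
  assumes H: "H \<in> borel_measurable (borel \<Otimes>\<^sub>M borel)"
  shows "(\<integral>\<^sup>+z. H z \<partial>factorial_moment_measure) =
    (\<integral>\<^sup>+w. \<integral>\<^sup>+(i, j). H (X i w, X j w) \<partial>count_space index_pairs \<partial>M)"
proof -
  note H[measurable] pair_points_measurable[measurable] points_measurable[measurable]
  have "(\<integral>\<^sup>+z. H z \<partial>factorial_moment_measure) =
      (\<integral>\<^sup>+z. H ((\<lambda>((i, j), w). (X i w, X j w)) z) \<partial>(count_space index_pairs \<Otimes>\<^sub>M M))"
    unfolding factorial_moment_measure_def by (rule nn_integral_distr) measurable
  also have "\<dots> = (\<integral>\<^sup>+p. \<integral>\<^sup>+w. H ((\<lambda>((i, j), w). (X i w, X j w)) (p, w)) \<partial>M \<partial>count_space index_pairs)"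
    by (rule nn_integral_fst[symmetric]) measurable
  also have "\<dots> = (\<integral>\<^sup>+w. \<integral>\<^sup>+p. H ((\<lambda>((i, j), w). (X i w, X j w)) (p, w)) \<partial>count_space index_pairs \<partial>M)"
    by (rule nn_integral_count_space_nn_integral[symmetric, OF countable_index_pairs])
       (auto simp: case_prod_beta)
  finally show ?thesis by (simp add: case_prod_beta')
qed

lemma emeasure_factorial_moment_measure:
  assumes A: "A \<in> sets borel" and B: "B \<in> sets borel"
  shows "emeasure factorial_moment_measure (A \<times> B) =
    (\<integral>\<^sup>+w. \<integral>\<^sup>+(i, j). indicator A (X i w) * indicator B (X j w) \<partial>count_space index_pairs \<partial>M)"
proof -
  have AB: "A \<times> B \<in> sets (borel \<Otimes>\<^sub>M borel)" using A B by simp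
  have "emeasure factorial_moment_measure (A \<times> B) = (\<integral>\<^sup>+z. indicator (A \<times> B) z \<partial>factorial_moment_measure)"
    using AB by (intro nn_integral_indicator[symmetric]) (simp add: factorial_moment_measure_def)
  also have "\<dots> = (\<integral>\<^sup>+w. \<integral>\<^sup>+(i, j). indicator (A \<times> B) (X i w, X j w) \<partial>count_space index_pairs \<partial>M)"
    using AB by (intro nn_integral_factorial_moment_measure) simp
  finally show ?thesis by (simp add: indicator_times case_prod_beta)
qed

lemma AE_finite_index_set:
  "AE w in M. \<forall>B. bounded B \<longrightarrow>
     finite {i. X i w \<in> B} \<and> card {i. X i w \<in> B} = card (range (\<lambda>n. X n w) \<inter> B)"
  using locally_finite points_distinct
proof eventually_elim
  case (elim w)
  show ?case
  proof (intro allI impI conjI)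
    fix B :: "'b set" assume B: "bounded B"
    have im: "(\<lambda>i. X i w) ` {i. X i w \<in> B} = range (\<lambda>n. X n w) \<inter> B" by auto
    have inj: "inj_on (\<lambda>i. X i w) {i. X i w \<in> B}"
      using elim(2) by (rule inj_on_subset) simp
    show "finite {i. X i w \<in> B}"
      using elim(1) B im by (intro finite_imageD[OF _ inj]) auto
    show "card {i. X i w \<in> B} = card (range (\<lambda>n. X n w) \<inter> B)"
      using card_image[OF inj] im by simp
  qed
qed

text \<open>
  For disjoint sets this is independence of the counts; for equal sets it is the second factorial
  moment of the Poisson distribution, since a set of \<open>n\<close> points has \<open>n * (n - 1)\<close> ordered pairs of
  distinct points. The general case follows by additivity.
\<close>

lemma factorial_moment_measure_Times:
  assumes A: "bounded A" "A \<in> sets borel" and B: "bounded B" "B \<in> sets borel"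
  shows "emeasure factorial_moment_measure (A \<times> B) =
    ennreal (\<rho> * measure lborel A) * ennreal (\<rho> * measure lborel B)"
proof -
  let ?\<alpha> = "emeasure factorial_moment_measure"
  let ?l = "\<lambda>A. ennreal (\<rho> * measure lborel A)"
  \<comment> \<open>\<open>c\<close> is the formula for the number of off-diagonal pairs in terms of the two counts. It is
    \<open>k * l\<close> for disjoint sets and \<open>k * (l - 1)\<close> for equal ones.\<close>
  have counts: "?\<alpha> (S \<times> T) = (\<integral>\<^sup>+w. ennreal (real (c (card (range (\<lambda>n. X n w) \<inter> S)) (card (range (\<lambda>n. X n w) \<inter> T)))) \<partial>M)"
    if S: "bounded S" "S \<in> sets borel" and T: "bounded T" "T \<in> sets borel"
      and c: "\<And>I J :: nat set. finite I \<Longrightarrow> finite J \<Longrightarrow> (S = T \<longrightarrow> I = J) \<Longrightarrow> (S \<inter> T = {} \<longrightarrow> I \<inter> J = {}) \<Longrightarrow>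
        card ((I \<times> J) - Id) = c (card I) (card J)" for S T and c :: "nat \<Rightarrow> nat \<Rightarrow> nat"
  proof -
    have "AE w in M. (\<integral>\<^sup>+(i, j). indicator S (X i w) * indicator T (X j w) \<partial>count_space index_pairs) =
        ennreal (real (c (card (range (\<lambda>n. X n w) \<inter> S)) (card (range (\<lambda>n. X n w) \<inter> T))))"
      using AE_finite_index_set
    proof eventually_elim
      case (elim w)
      let ?I = "\<lambda>S. {i. X i w \<in> S}"
      have fin: "finite (?I S)" "finite (?I T)" using elim S T by auto
      have "(\<integral>\<^sup>+(i, j). indicator S (X i w) * indicator T (X j w) \<partial>count_space index_pairs) =
          (\<integral>\<^sup>+(i, j). indicator (?I S) i * indicator (?I T) j \<partial>count_space index_pairs)"
        by (intro nn_integral_cong) (auto simp: indicator_def)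
      also have "\<dots> = ennreal (real (card ((?I S \<times> ?I T) - Id)))"
        by (rule nn_integral_off_diagonal_pairs[OF fin])
      also have "card ((?I S \<times> ?I T) - Id) = c (card (?I S)) (card (?I T))"
        using fin by (intro c) auto
      finally show ?case using elim S T by simp
    qed
    then show ?thesis
      unfolding emeasure_factorial_moment_measure[OF S(2) T(2)] by (rule nn_integral_cong_AE)
  qed
  have disj: "?\<alpha> (S \<times> T) = ?l S * ?l T"
    if S: "bounded S" "S \<in> sets borel" and T: "bounded T" "T \<in> sets borel" and "S \<inter> T = {}" for S T
  proof -
    have "card ((I \<times> J) - Id) = card I * card J" if "I \<inter> J = {}" for I J :: "nat set"
    proof -
      have "(I \<times> J) - Id = I \<times> J" using that by auto
      then show ?thesis by (simp add: card_cartesian_product)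
    qed
    then show ?thesis
      using counts[OF S T, of "\<lambda>k l. k * l"] count_product_moment[OF S T] \<open>S \<inter> T = {}\<close> by simp
  qed
  have same: "?\<alpha> (S \<times> S) = ?l S * ?l S" if S: "bounded S" "S \<in> sets borel" for S
  proof -
    have "card ((I \<times> I) - Id) = card I * (card I - 1)" if I: "finite I" for I :: "nat set"
    proof -
      have "card ((I \<times> I) - Id_on I) = card (I \<times> I) - card (Id_on I)"
        using I by (intro card_Diff_subset finite_subset[OF Id_on_subset_Times]) auto
      moreover have "(I \<times> I) - Id = (I \<times> I) - Id_on I" by auto
      moreover have "card (Id_on I) = card I"
      proof -
        have "Id_on I = (\<lambda>i. (i, i)) ` I" by auto
        then show ?thesis by (simp add: card_image inj_on_def)
      qed
      ultimately show ?thesis by (simp add: card_cartesian_product diff_mult_distrib2)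
    qed
    then have "?\<alpha> (S \<times> S) = ennreal ((\<rho> * measure lborel S)\<^sup>2)"
      using counts[OF S S, of "\<lambda>k l. k * (l - 1)"] count_factorial_moment[OF S] by simp
    with mean_nonneg[OF S] show ?thesis by (simp add: ennreal_mult power2_eq_square)
  qed
  have add: "?l S = ?l (S - T) + ?l (S \<inter> T)"
    if S: "bounded S" "S \<in> sets borel" and T: "T \<in> sets borel" for S T :: "'b set"
  proof -
    have b: "bounded (S - T)" "bounded (S \<inter> T)" using S by (auto intro: bounded_subset)
    have m: "S - T \<in> sets borel" "S \<inter> T \<in> sets borel" using S T by auto
    have "measure lborel ((S - T) \<union> (S \<inter> T)) = measure lborel (S - T) + measure lborel (S \<inter> T)"
      using m emeasure_bounded_finite[OF b(1)] emeasure_bounded_finite[OF b(2)]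
      by (intro measure_Union) auto
    moreover have "(S - T) \<union> (S \<inter> T) = S" by auto
    ultimately have "\<rho> * measure lborel S = \<rho> * measure lborel (S - T) + \<rho> * measure lborel (S \<inter> T)"
      by (simp add: distrib_left)
    then show ?thesis using mean_nonneg[OF b(1) m(1)] mean_nonneg[OF b(2) m(2)] by simp
  qed
  \<comment> \<open>The pieces \<open>A - B\<close>, \<open>A \<inter> B\<close>, \<open>B - A\<close> are pairwise disjoint, so each of the four products below is
    of one of the two kinds already treated.\<close>
  let ?D = "A \<inter> B" let ?A = "A - B" let ?B = "B - A"
  have bnd: "bounded ?D" "bounded ?A" "bounded ?B"
    using A B by (auto intro: bounded_subset)
  have brl: "?D \<in> sets borel" "?A \<in> sets borel" "?B \<in> sets borel" using A B by auto
  have \<alpha>_sets: "S \<times> T \<in> sets factorial_moment_measure" if "S \<in> sets borel" "T \<in> sets borel" for S T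
    using that by (simp add: factorial_moment_measure_def)
  have "?\<alpha> (A \<times> B) = ?\<alpha> ((?A \<times> ?B \<union> ?A \<times> ?D) \<union> (?D \<times> ?B \<union> ?D \<times> ?D))"
    by (rule arg_cong[where f = "?\<alpha>"]) auto
  also have "\<dots> = ?\<alpha> (?A \<times> ?B \<union> ?A \<times> ?D) + ?\<alpha> (?D \<times> ?B \<union> ?D \<times> ?D)"
    using brl \<alpha>_sets by (intro plus_emeasure[symmetric] sets.Un) auto
  also have "?\<alpha> (?A \<times> ?B \<union> ?A \<times> ?D) = ?\<alpha> (?A \<times> ?B) + ?\<alpha> (?A \<times> ?D)"
    using brl \<alpha>_sets by (intro plus_emeasure[symmetric]) auto
  also have "?\<alpha> (?D \<times> ?B \<union> ?D \<times> ?D) = ?\<alpha> (?D \<times> ?B) + ?\<alpha> (?D \<times> ?D)"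
    using brl \<alpha>_sets by (intro plus_emeasure[symmetric]) auto
  also have "?\<alpha> (?A \<times> ?B) = ?l ?A * ?l ?B" using bnd brl by (intro disj) auto
  also have "?\<alpha> (?A \<times> ?D) = ?l ?A * ?l ?D" using bnd brl by (intro disj) auto
  also have "?\<alpha> (?D \<times> ?B) = ?l ?D * ?l ?B" using bnd brl by (intro disj) auto
  also have "?\<alpha> (?D \<times> ?D) = ?l ?D * ?l ?D" using bnd brl by (intro same) auto
  also have "?l ?A * ?l ?B + ?l ?A * ?l ?D + (?l ?D * ?l ?B + ?l ?D * ?l ?D) =
      (?l ?A + ?l ?D) * (?l ?B + ?l ?D)"
    by (simp only: distrib_left distrib_right add_ac)
  also have "?l ?A + ?l ?D = ?l A" using add[OF A B(2)] by simp
  also have "?l ?B + ?l ?D = ?l B" using add[OF B A(2)] by (simp add: Int_commute)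
  finally show ?thesis .
qed

text \<open>
  The counts are only controlled on bounded sets. One factor at a time is exhausted by balls, because
  multiplication by a fixed extended number commutes with suprema even when one factor is zero and the
  other infinite.
\<close>

lemma factorial_moment_measure_eq:
  assumes "0 < \<rho>"
  shows "factorial_moment_measure =
    density lborel (\<lambda>_. ennreal \<rho>) \<Otimes>\<^sub>M density lborel (\<lambda>_. ennreal \<rho>)"
proof (rule pair_measure_eqI[symmetric])
  let ?\<nu> = "density lborel (\<lambda>_. ennreal \<rho>) :: 'b measure"
  let ?\<alpha> = factorial_moment_measure
  let ?b = "\<lambda>S n. S \<inter> cball (0::'b) (real n)"
  show "sigma_finite_measure ?\<nu>" "sigma_finite_measure ?\<nu>"
    by (simp_all add: sigma_finite_measure.sigma_finite_iff_density_finite[OF sigma_finite_lborel])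
  show "sets (?\<nu> \<Otimes>\<^sub>M ?\<nu>) = sets ?\<alpha>"
    by (simp add: factorial_moment_measure_def cong: sets_pair_measure_cong)
  have \<alpha>_sets: "S \<times> T \<in> sets ?\<alpha>" if "S \<in> sets borel" "T \<in> sets borel" for S T
    using that by (simp add: factorial_moment_measure_def)
  have \<nu>: "emeasure ?\<nu> S = ennreal (\<rho> * measure lborel S)" if "bounded S" "S \<in> sets borel" for S
  proof -
    have "emeasure lborel S = ennreal (measure lborel S)"
      using emeasure_bounded_finite[OF that(1)] by (intro emeasure_eq_ennreal_measure) auto
    then show ?thesis using assms that by (simp add: emeasure_density_const ennreal_mult')
  qed
  have b: "bounded (?b S n)" "?b S n \<in> sets borel" if "S \<in> sets borel" for S n
    using that by (auto intro: bounded_subset[OF bounded_cball])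
  have exhaust: "(\<Union>n. ?b S n) = S" for S
    using real_arch_simple by (auto simp: dist_norm)
  have inc: "incseq (?b S)" for S
    by (auto simp: incseq_def)
  have sup\<nu>: "(SUP n. emeasure ?\<nu> (?b S n)) = emeasure ?\<nu> S" if "S \<in> sets borel" for S
  proof -
    have "(SUP n. emeasure ?\<nu> (?b S n)) = emeasure ?\<nu> (\<Union>n. ?b S n)"
      using b(2)[OF that] inc[of S] by (intro SUP_emeasure_incseq) auto
    then show ?thesis by (simp only: exhaust)
  qed
  have bdd: "emeasure ?\<nu> S * emeasure ?\<nu> T = emeasure ?\<alpha> (S \<times> T)"
    if S: "bounded S" "S \<in> sets borel" and T: "T \<in> sets borel" for S T
  proof -
    have "emeasure ?\<nu> S * emeasure ?\<nu> T = (SUP n. emeasure ?\<nu> S * emeasure ?\<nu> (?b T n))"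
      by (simp add: sup\<nu>[OF T, symmetric] SUP_mult_left_ennreal)
    also have "\<dots> = (SUP n. emeasure ?\<alpha> (S \<times> ?b T n))"
      using S b[OF T] by (simp add: \<nu> factorial_moment_measure_Times)
    also have "\<dots> = emeasure ?\<alpha> (\<Union>n. S \<times> ?b T n)"
      using S b[OF T] \<alpha>_sets inc[of T] by (intro SUP_emeasure_incseq) (auto simp: incseq_def)
    also have "(\<Union>n. S \<times> ?b T n) = S \<times> T" using exhaust[of T] by blast
    finally show ?thesis .
  qed
  fix A B assume "A \<in> sets ?\<nu>" "B \<in> sets ?\<nu>"
  then have A: "A \<in> sets borel" and B: "B \<in> sets borel" by auto
  have "emeasure ?\<nu> A * emeasure ?\<nu> B = (SUP n. emeasure ?\<nu> B * emeasure ?\<nu> (?b A n))"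
    by (simp add: sup\<nu>[OF A, symmetric] SUP_mult_left_ennreal mult.commute)
  also have "\<dots> = (SUP n. emeasure ?\<alpha> (?b A n \<times> B))"
    using bdd[OF b[OF A] B] by (simp add: mult.commute)
  also have "\<dots> = emeasure ?\<alpha> (\<Union>n. ?b A n \<times> B)"
    using b[OF A] B \<alpha>_sets inc[of A] by (intro SUP_emeasure_incseq) (auto simp: incseq_def)
  also have "(\<Union>n. ?b A n \<times> B) = A \<times> B" using exhaust[of A] by blast
  finally show "emeasure ?\<nu> A * emeasure ?\<nu> B = emeasure ?\<alpha> (A \<times> B)" .
qed

lemma campbell_pairs:
  assumes \<rho>: "0 < \<rho>" and H: "(\<lambda>(x, y). H x y) \<in> borel_measurable (borel \<Otimes>\<^sub>M borel)"
  shows "(\<integral>\<^sup>+w. \<integral>\<^sup>+(i, j). H (X i w) (X j w) \<partial>count_space index_pairs \<partial>M) =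
    ennreal (\<rho>\<^sup>2) * (\<integral>\<^sup>+x. \<integral>\<^sup>+y. H x y \<partial>lborel \<partial>lborel)"
proof -
  let ?\<nu> = "density lborel (\<lambda>_. ennreal \<rho>) :: 'b measure"
  have sets: "sets (?\<nu> \<Otimes>\<^sub>M ?\<nu>) = sets (borel \<Otimes>\<^sub>M borel)"
    by (intro sets_pair_measure_cong) auto
  have sf: "sigma_finite_measure ?\<nu>"
    by (simp add: sigma_finite_measure.sigma_finite_iff_density_finite[OF sigma_finite_lborel])
  note H[measurable]
  have "(\<integral>\<^sup>+w. \<integral>\<^sup>+(i, j). H (X i w) (X j w) \<partial>count_space index_pairs \<partial>M) =
      (\<integral>\<^sup>+z. (\<lambda>(x, y). H x y) z \<partial>(?\<nu> \<Otimes>\<^sub>M ?\<nu>))"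
    unfolding factorial_moment_measure_eq[OF \<rho>, symmetric]
    by (subst nn_integral_factorial_moment_measure) (auto simp: case_prod_beta)
  also have "\<dots> = (\<integral>\<^sup>+x. \<integral>\<^sup>+y. (\<lambda>(x, y). H x y) (x, y) \<partial>?\<nu> \<partial>?\<nu>)"
    by (rule sigma_finite_measure.nn_integral_fst[OF sf, symmetric])
       (simp add: measurable_cong_sets[OF sets refl])
  also have "\<dots> = (\<integral>\<^sup>+x. ennreal \<rho> * (\<integral>\<^sup>+y. ennreal \<rho> * H x y \<partial>lborel) \<partial>lborel)"
    by (simp add: nn_integral_density)
  also have "\<dots> = ennreal \<rho> * ennreal \<rho> * (\<integral>\<^sup>+x. \<integral>\<^sup>+y. H x y \<partial>lborel \<partial>lborel)"
    by (simp add: nn_integral_cmult mult.assoc)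
  finally show ?thesis using \<rho> by (simp add: ennreal_mult power2_eq_square)
qed

end

section \<open>Expected sums over the edges\<close>

context random_connection_model
begin

abbreviation edge_event :: "nat \<Rightarrow> nat \<Rightarrow> 'w set" where
  "edge_event i j \<equiv> {w \<in> space M. (X i w, X j w) \<in> E w}"

lemma edge_event_commute: "edge_event i j = edge_event j i"
  using edges_graph by (auto dest: symD)

lemma edge_event_measurable: "i \<noteq> j \<Longrightarrow> edge_event i j \<in> sets M"
  using edges_measurable[of i j] edges_measurable[of j i] edge_event_commute[of i j]
  by (cases "i < j") auto

text \<open>
  Given the points, the edge is present with probability \<open>g (X i - X j)\<close>; the factor
  \<open>k (X i) (X j)\<close> is a function of the points alone and can be taken out of the conditional
  expectation. Boundedness of \<open>k\<close> and \<open>g\<close> provides the integrability.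
\<close>

lemma nn_integral_edge_lt:
  assumes ij: "i < j"
    and g: "g \<in> borel_measurable borel" "\<And>x. 0 \<le> g x" "\<And>x. g x \<le> 1"
    and k: "(\<lambda>(x, y). k x y) \<in> borel_measurable (borel \<Otimes>\<^sub>M borel)"
      "\<And>x y. 0 \<le> k x y" "\<And>x y. k x y \<le> 1"
  shows "(\<integral>\<^sup>+w. ennreal (k (X i w) (X j w)) * indicator (edge_event i j) w \<partial>M) =
    (\<integral>\<^sup>+w. ennreal (k (X i w) (X j w) * g (X i w - X j w)) \<partial>M)"
proof -
  note [measurable] = g(1) k(1) points_measurable
  have ev[measurable]: "edge_event i j \<in> sets M" using edges_measurable[OF ij] .
  let ?S = "Pi\<^sub>M (UNIV :: nat set) (\<lambda>_. borel :: 'b measure)"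
  define F where "F = vimage_algebra (space M) (\<lambda>w n. X n w) ?S"
  let ?f = "\<lambda>w. k (X i w) (X j w)"
  have XS: "(\<lambda>w n. X n w) \<in> M \<rightarrow>\<^sub>M ?S"
    by (rule measurable_PiM_single') (simp_all add: points_measurable)
  have sub: "subalgebra M F"
    unfolding subalgebra_def F_def using sets_image_in_sets[OF refl XS] by simp
  interpret finite_measure_subalgebra M F
    using sub by unfold_locales
  have [measurable]: "X n \<in> F \<rightarrow>\<^sub>M borel" for n
  proof -
    have "(\<lambda>w n. X n w) \<in> F \<rightarrow>\<^sub>M ?S"
      unfolding F_def by (rule measurable_vimage_algebra1) (simp add: space_PiM)
    from measurable_compose[OF this measurable_component_singleton[of n UNIV "\<lambda>_. borel"]]
    show ?thesis by simp
  qed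
  have fF: "?f \<in> borel_measurable F" by measurable
  have fM: "?f \<in> borel_measurable M" by measurable
  have int: "integrable M (\<lambda>w. ?f w * indicator (edge_event i j) w)"
    using k by (intro integrable_const_bound[where B = 1]) (auto simp: indicator_def)
  have int': "integrable M (\<lambda>w. ?f w * g (X i w - X j w))"
    using k g by (intro integrable_const_bound[where B = 1]) (auto simp: mult_le_one)
  have law: "AE w in M. real_cond_exp M F (indicator (edge_event i j)) w = g (X i w - X j w)"
    using edges_conditional_law[of "{(i, j)}"] ij by (simp add: F_def)
  have "(\<integral>\<^sup>+w. ennreal (?f w) * indicator (edge_event i j) w \<partial>M) =
      (\<integral>\<^sup>+w. ennreal (?f w * indicator (edge_event i j) w) \<partial>M)"
    by (intro nn_integral_cong) (auto simp: indicator_def)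
  also have "\<dots> = ennreal (\<integral>w. ?f w * indicator (edge_event i j) w \<partial>M)"
    using k by (intro nn_integral_eq_integral int) auto
  also have "(\<integral>w. ?f w * indicator (edge_event i j) w \<partial>M) =
      (\<integral>w. ?f w * real_cond_exp M F (indicator (edge_event i j)) w \<partial>M)"
    by (rule real_cond_exp_intg(2)[symmetric, OF int fF]) simp
  also have "\<dots> = (\<integral>w. ?f w * g (X i w - X j w) \<partial>M)"
    using law by (intro integral_cong_AE) auto
  also have "ennreal \<dots> = (\<integral>\<^sup>+w. ennreal (?f w * g (X i w - X j w)) \<partial>M)"
    using k g by (intro nn_integral_eq_integral[symmetric] int') auto
  finally show ?thesis .
qed

lemma nn_integral_edge:
  assumes ij: "i \<noteq> j"
    and g: "g \<in> borel_measurable borel" "\<And>x. 0 \<le> g x" "\<And>x. g x \<le> 1" "\<And>x. g (- x) = g x"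
    and k: "(\<lambda>(x, y). k x y) \<in> borel_measurable (borel \<Otimes>\<^sub>M borel)"
      "\<And>x y. 0 \<le> k x y" "\<And>x y. k x y \<le> 1"
  shows "(\<integral>\<^sup>+w. ennreal (k (X i w) (X j w)) * indicator (edge_event i j) w \<partial>M) =
    (\<integral>\<^sup>+w. ennreal (k (X i w) (X j w) * g (X i w - X j w)) \<partial>M)"
proof (cases "i < j")
  case True
  then show ?thesis using g(1-3) k by (rule nn_integral_edge_lt)
next
  case False
  note k(1)[measurable]
  have "(\<integral>\<^sup>+w. ennreal ((\<lambda>x y. k y x) (X j w) (X i w)) * indicator (edge_event j i) w \<partial>M) =
    (\<integral>\<^sup>+w. ennreal ((\<lambda>x y. k y x) (X j w) (X i w) * g (X j w - X i w)) \<partial>M)"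
    using False ij by (intro nn_integral_edge_lt g k) (auto simp: measurable_split_conv)
  moreover have "g (X j w - X i w) = g (X i w - X j w)" for w
    using g(4)[of "X i w - X j w"] by simp
  ultimately show ?thesis by (simp add: edge_event_commute[of i j])
qed

definition edge_functional :: "('b \<Rightarrow> 'b \<Rightarrow> real) \<Rightarrow> 'w \<Rightarrow> ennreal" where
  "edge_functional k w =
     (\<integral>\<^sup>+(i, j). ennreal (k (X i w) (X j w)) * indicator (edge_event i j) w \<partial>count_space index_pairs)"

lemma edge_summand_measurable:
  assumes k: "(\<lambda>(x, y). k x y) \<in> borel_measurable (borel \<Otimes>\<^sub>M borel)" and p: "p \<in> index_pairs"
  shows "(\<lambda>w. ennreal (k (X (fst p) w) (X (snd p) w)) * indicator (edge_event (fst p) (snd p)) w)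
    \<in> borel_measurable M"
proof -
  note [measurable] = k points_measurable
  have [measurable]: "edge_event (fst p) (snd p) \<in> sets M"
    using p by (cases p) (auto intro!: edge_event_measurable)
  show ?thesis by measurable
qed

lemma edge_functional_measurable:
  assumes k: "(\<lambda>(x, y). k x y) \<in> borel_measurable (borel \<Otimes>\<^sub>M borel)"
  shows "edge_functional k \<in> borel_measurable M"
proof -
  have "(\<lambda>(p, w). ennreal (k (X (fst p) w) (X (snd p) w)) * indicator (edge_event (fst p) (snd p)) w)
      \<in> borel_measurable (count_space index_pairs \<Otimes>\<^sub>M M)"
  proof (rule measurable_pair_measure_countable1[OF countable_index_pairs])
    fix p assume p: "p \<in> index_pairs"
    show "(\<lambda>w. case (p, w) of (p, w) \<Rightarrow> ennreal (k (X (fst p) w) (X (snd p) w)) *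
        indicator (edge_event (fst p) (snd p)) w) \<in> borel_measurable M"
      unfolding prod.case by (rule edge_summand_measurable[OF k p])
  qed
  then have sw: "(\<lambda>(w, p). ennreal (k (X (fst p) w) (X (snd p) w)) * indicator (edge_event (fst p) (snd p)) w)
      \<in> borel_measurable (M \<Otimes>\<^sub>M count_space index_pairs)"
    by (subst measurable_pair_swap_iff) (simp add: case_prod_beta')
  interpret P: sigma_finite_measure "count_space index_pairs"
    by (rule sigma_finite_measure_count_space_countable[OF countable_index_pairs])
  show ?thesis
    using P.borel_measurable_nn_integral[OF sw]
    by (simp add: edge_functional_def[abs_def] case_prod_beta')
qed

text \<open>
  Two averages are taken in turn: over the edges given the points, which replaces the indicator of
  the edge by \<open>g\<close>, and over the points, whose ordered pairs have the product intensity.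
\<close>

lemma edge_functional_mean:
  assumes \<rho>: "0 < \<rho>"
    and g: "g \<in> borel_measurable borel" "\<And>x. 0 \<le> g x" "\<And>x. g x \<le> 1" "\<And>x. g (- x) = g x"
    and k: "(\<lambda>(x, y). k x y) \<in> borel_measurable (borel \<Otimes>\<^sub>M borel)"
      "\<And>x y. 0 \<le> k x y" "\<And>x y. k x y \<le> 1"
  shows "(\<integral>\<^sup>+w. edge_functional k w \<partial>M) =
    ennreal (\<rho>\<^sup>2) * (\<integral>\<^sup>+x. \<integral>\<^sup>+y. ennreal (k x y * g (x - y)) \<partial>lborel \<partial>lborel)"
proof -
  note [measurable] = k(1) g(1) points_measurable
  have "(\<integral>\<^sup>+w. edge_functional k w \<partial>M) = (\<integral>\<^sup>+p. \<integral>\<^sup>+w. ennreal (k (X (fst p) w) (X (snd p) w)) *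
      indicator (edge_event (fst p) (snd p)) w \<partial>M \<partial>count_space index_pairs)"
    unfolding edge_functional_def case_prod_beta
    by (rule nn_integral_count_space_nn_integral[OF countable_index_pairs edge_summand_measurable[OF k(1)]])
  also have "\<dots> = (\<integral>\<^sup>+p. \<integral>\<^sup>+w. ennreal (k (X (fst p) w) (X (snd p) w) * g (X (fst p) w - X (snd p) w)) \<partial>M
      \<partial>count_space index_pairs)"
    by (intro nn_integral_cong nn_integral_edge g k) auto
  also have "\<dots> = (\<integral>\<^sup>+w. \<integral>\<^sup>+p. ennreal (k (X (fst p) w) (X (snd p) w) * g (X (fst p) w - X (snd p) w))
      \<partial>count_space index_pairs \<partial>M)"
    by (rule nn_integral_count_space_nn_integral[symmetric, OF countable_index_pairs]) auto
  also have "\<dots> = ennreal (\<rho>\<^sup>2) * (\<integral>\<^sup>+x. \<integral>\<^sup>+y. ennreal (k x y * g (x - y)) \<partial>lborel \<partial>lborel)"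
    using campbell_pairs[OF \<rho>, of "\<lambda>x y. ennreal (k x y * g (x - y))"]
    by (simp add: case_prod_beta')
  finally show ?thesis .
qed

text \<open>
  The functional is a sum over indices, which makes it measurable and lets expectation be computed
  term by term; almost surely the points are distinct and it is the sum over the edge set itself.
\<close>

lemma edge_functional_eq:
  assumes w: "w \<in> space M" and inj: "inj (\<lambda>n. X n w)"
  shows "edge_functional k w = (\<integral>\<^sup>+(x, y). ennreal (k x y) \<partial>count_space (E w))"
proof -
  let ?e = "\<lambda>(i, j). (X i w, X j w)"
  let ?I = "{p \<in> index_pairs. ?e p \<in> E w}"
  have graph: "E w \<subseteq> range (\<lambda>n. X n w) \<times> range (\<lambda>n. X n w)" "irrefl (E w)"
    using edges_graph[OF w] by auto
  have "bij_betw ?e ?I (E w)"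
  proof (rule bij_betw_imageI)
    show "inj_on ?e ?I" using inj by (auto simp: inj_on_def)
    show "?e ` ?I = E w"
    proof
      show "E w \<subseteq> ?e ` ?I"
      proof
        fix z assume z: "z \<in> E w"
        then obtain i j where ij: "z = (X i w, X j w)" using graph(1) by auto
        moreover have "i \<noteq> j" using z ij graph(2) by (auto simp: irrefl_def)
        ultimately have "(i, j) \<in> ?I" "z = ?e (i, j)" using z by auto
        then show "z \<in> ?e ` ?I" by (rule image_eqI[rotated])
      qed
    qed auto
  qed
  then have "(\<integral>\<^sup>+(x, y). ennreal (k x y) \<partial>count_space (E w)) =
      (\<integral>\<^sup>+p. (case ?e p of (x, y) \<Rightarrow> ennreal (k x y)) \<partial>count_space ?I)"
    by (rule nn_integral_bij_count_space[symmetric])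
  also have "\<dots> = edge_functional k w"
    unfolding edge_functional_def using w
    by (subst (1 2) nn_integral_count_space_indicator) (auto intro!: nn_integral_cong simp: indicator_def)
  finally show ?thesis by simp
qed

end

lemma measurable_indicator_fst:
  assumes "A \<in> sets M"
  shows "(\<lambda>(x, y). indicator A x :: real) \<in> borel_measurable (M \<Otimes>\<^sub>M N)"
  unfolding case_prod_beta'
  using assms by (intro measurable_compose[OF measurable_fst] borel_measurable_indicator)

context random_connection_model
begin

text \<open>
  The sums over the edges that start in a given ball have finite mean, hence are finite almost surely, and
  countably many balls cover the space.
\<close>

lemma AE_finite_degrees:
  assumes fin: "\<And>m. (\<integral>\<^sup>+w. edge_functional (\<lambda>x y. indicator (cball 0 (real m)) x) w \<partial>M) < \<infinity>"
  shows "AE w in M. \<forall>x. finite (E w `` {x})"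
proof -
  let ?L = "\<lambda>m. edge_functional (\<lambda>x y. indicator (cball 0 (real m)) x)"
  have "AE w in M. \<forall>m. ?L m w \<noteq> \<infinity>"
  proof (subst AE_all_countable, rule allI)
    fix m
    show "AE w in M. ?L m w \<noteq> \<infinity>"
    proof (rule nn_integral_PInf_AE)
      show "?L m \<in> borel_measurable M"
        by (intro edge_functional_measurable measurable_indicator_fst) simp
      show "(\<integral>\<^sup>+w. ?L m w \<partial>M) \<noteq> \<infinity>" using fin[of m] by simp
    qed
  qed
  with AE_space points_distinct show ?thesis
  proof eventually_elim
    case (elim w)
    show ?case
    proof
      fix x :: 'b
      obtain m where m: "norm x \<le> real m" using real_arch_simple by blast
      let ?A = "{z \<in> E w. fst z \<in> cball 0 (real m)}"
      have "?L m w = (\<integral>\<^sup>+z. indicator ?A z \<partial>count_space (E w))"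
        unfolding edge_functional_eq[OF elim(1,2)]
        by (intro nn_integral_cong) (auto simp: indicator_def)
      also have "\<dots> = emeasure (count_space (E w)) ?A" by (intro nn_integral_indicator) auto
      finally have "emeasure (count_space (E w)) ?A \<noteq> \<infinity>" using elim(3) by metis
      then have "finite ?A" by (subst (asm) emeasure_count_space) (auto split: if_splits)
      then have "finite (snd ` ?A)" by (rule finite_imageI)
      moreover have "E w `` {x} \<subseteq> snd ` ?A" using m by (force simp: image_iff)
      ultimately show "finite (E w `` {x})" by (rule finite_subset[rotated])
    qed
  qed
qed

text \<open>
  The infimum over a tail is below every term of the tail, so its mean is zero. This replaces the
  choice of an almost surely convergent subsequence.
\<close>

lemma AE_edge_functional_small:
  assumes k: "\<And>n. (\<lambda>(x, y). k n x y) \<in> borel_measurable (borel \<Otimes>\<^sub>M borel)"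
    and lim: "(\<lambda>n. \<integral>\<^sup>+w. edge_functional (k n) w \<partial>M) \<longlonglongrightarrow> 0"
  shows "AE w in M. \<forall>m. (INF n\<in>{m..}. edge_functional (k n) w) = 0"
proof (subst AE_all_countable, rule allI)
  fix m :: nat
  note [measurable] = edge_functional_measurable[OF k]
  have "(\<integral>\<^sup>+w. (INF n\<in>{m..}. edge_functional (k n) w) \<partial>M) \<le> 0"
  proof (rule LIMSEQ_le_const[OF lim], intro exI allI impI)
    fix n assume "m \<le> n"
    then show "(\<integral>\<^sup>+w. (INF n\<in>{m..}. edge_functional (k n) w) \<partial>M) \<le> (\<integral>\<^sup>+w. edge_functional (k n) w \<partial>M)"
      by (intro nn_integral_mono INF_lower) auto
  qed
  moreover have "(\<lambda>w. INF n\<in>{m..}. edge_functional (k n) w) \<in> borel_measurable M"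
    by (intro borel_measurable_INF) auto
  ultimately show "AE w in M. (INF n\<in>{m..}. edge_functional (k n) w) = 0"
    by (subst (asm) le_zero_eq, subst (asm) nn_integral_0_iff_AE) auto
qed

end

section \<open>Recurrence of the planar random connection model\<close>

theorem theorem3p1:
  fixes M :: "'w measure" and \<rho> s :: real
    and g :: "real^2 \<Rightarrow> real"
    and X :: "nat \<Rightarrow> 'w \<Rightarrow> real^2" and E :: "'w \<Rightarrow> (real^2) rel"
  assumes "\<rho> > 0"
    and "g \<in> borel_measurable borel"
    and "\<And>x. 0 \<le> g x \<and> g x \<le> 1"
    and "\<And>x. g (- x) = g x"
    and "0 < (\<integral>\<^sup>+x. ennreal (g x) \<partial>lborel)"
    and "(\<integral>\<^sup>+x. ennreal (g x) \<partial>lborel) < \<infinity>"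
    and "\<And>x y. norm1 x \<le> norm1 y \<Longrightarrow> g y \<le> g x"
    and "s \<ge> 4"
    and "bdd_above ((\<lambda>x. g x / norm1 x powr (- s)) ` (UNIV - {0}))"
    and "random_connection_model M \<rho> X g E"
  shows "AE w in M. \<forall>C \<in> graph_components (range (\<lambda>n. X n w)) (E w).
           \<not> is_singleton C \<longrightarrow> recurrent_component (E w) C"
proof -
  interpret random_connection_model M \<rho> X g E by fact
  note \<rho> = assms(1)
  note g = assms(2) conjunct1[OF assms(3)] conjunct2[OF assms(3)] assms(4)
  obtain K where K: "0 < K" "\<And>x. g x \<le> K / (1 + norm x) ^ 4"
    using polynomial_decay_bound[OF g(3) assms(8,9)] by blast
  define k where "k n x y = (log_cutoff n x - log_cutoff n y)\<^sup>2" for n x y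
  have k_meas: "(\<lambda>(x, y). k n x y) \<in> borel_measurable (borel \<Otimes>\<^sub>M borel)" for n
    unfolding k_def by measurable
  have k01: "0 \<le> k n x y" "k n x y \<le> 1" for n x y
  proof -
    have "\<bar>log_cutoff n x - log_cutoff n y\<bar> \<le> 1"
      using log_cutoff_bounds[of n x] log_cutoff_bounds[of n y] by linarith
    then show "k n x y \<le> 1" by (simp add: k_def abs_square_le_1)
  qed (simp add: k_def)
  \<comment> \<open>Both first-moment bounds below, for the energies and for the degrees, only use that \<open>g\<close> is
    dominated by the critical kernel.\<close>
  have kernel: "(\<integral>\<^sup>+x. \<integral>\<^sup>+y. ennreal (c x y * g (x - y)) \<partial>lborel \<partial>lborel) \<le>
      ennreal K * (\<integral>\<^sup>+x. \<integral>\<^sup>+y. ennreal (c x y / (1 + dist x y) ^ 4) \<partial>lborel \<partial>lborel)"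
    if c: "(\<lambda>(x, y). c x y) \<in> borel_measurable (borel \<Otimes>\<^sub>M borel)" "\<And>x y. 0 \<le> c x y"
    for c :: "real^2 \<Rightarrow> real^2 \<Rightarrow> real"
  proof -
    note c(1)[measurable]
    have "ennreal (c x y * g (x - y)) \<le> ennreal K * ennreal (c x y / (1 + dist x y) ^ 4)" for x y
    proof -
      have "c x y * g (x - y) \<le> c x y * (K / (1 + norm (x - y)) ^ 4)"
        using c(2) K(2) by (intro mult_left_mono) auto
      then have "c x y * g (x - y) \<le> K * (c x y / (1 + dist x y) ^ 4)"
        by (simp add: dist_norm mult.commute)
      then show ?thesis using K(1) by (simp add: ennreal_mult'[symmetric] ennreal_leI)
    qed
    then have "(\<integral>\<^sup>+x. \<integral>\<^sup>+y. ennreal (c x y * g (x - y)) \<partial>lborel \<partial>lborel) \<le>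
        (\<integral>\<^sup>+x. \<integral>\<^sup>+y. ennreal K * ennreal (c x y / (1 + dist x y) ^ 4) \<partial>lborel \<partial>lborel)"
      by (intro nn_integral_mono)
    also have "\<dots> = ennreal K * (\<integral>\<^sup>+x. \<integral>\<^sup>+y. ennreal (c x y / (1 + dist x y) ^ 4) \<partial>lborel \<partial>lborel)"
      by (simp add: nn_integral_cmult)
    finally show ?thesis .
  qed
  have energy: "(\<integral>\<^sup>+w. edge_functional (k n) w \<partial>M) \<le> ennreal (\<rho>\<^sup>2 * K * 40 * pi\<^sup>2 / real n)"
    if n: "0 < n" for n
  proof -
    have "(\<integral>\<^sup>+w. edge_functional (k n) w \<partial>M) =
        ennreal (\<rho>\<^sup>2) * (\<integral>\<^sup>+x. \<integral>\<^sup>+y. ennreal (k n x y * g (x - y)) \<partial>lborel \<partial>lborel)"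
      by (rule edge_functional_mean[OF \<rho> g k_meas k01])
    also have "\<dots> \<le> ennreal (\<rho>\<^sup>2) * (ennreal K *
        (\<integral>\<^sup>+x. \<integral>\<^sup>+y. ennreal (k n x y / (1 + dist x y) ^ 4) \<partial>lborel \<partial>lborel))"
      by (intro mult_left_mono kernel k_meas k01) auto
    also have "\<dots> \<le> ennreal (\<rho>\<^sup>2) * (ennreal K * ennreal (40 * pi\<^sup>2 / real n))"
      unfolding k_def by (intro mult_left_mono nn_integral_log_cutoff_energy_le n) auto
    also have "\<dots> = ennreal (\<rho>\<^sup>2 * K * 40 * pi\<^sup>2 / real n)"
      using K(1) by (simp add: ennreal_mult'[symmetric] mult.assoc)
    finally show ?thesis .
  qed
  have "(\<lambda>n. \<integral>\<^sup>+w. edge_functional (k n) w \<partial>M) \<longlonglongrightarrow> 0"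
  proof (rule tendsto_sandwich[OF _ _ tendsto_const])
    have "(\<lambda>n. \<rho>\<^sup>2 * K * 40 * pi\<^sup>2 / real n) \<longlonglongrightarrow> 0" by real_asymp
    then show "(\<lambda>n. ennreal (\<rho>\<^sup>2 * K * 40 * pi\<^sup>2 / real n)) \<longlonglongrightarrow> 0"
      using tendsto_ennrealI by fastforce
    show "\<forall>\<^sub>F n in sequentially. (\<integral>\<^sup>+w. edge_functional (k n) w \<partial>M) \<le> ennreal (\<rho>\<^sup>2 * K * 40 * pi\<^sup>2 / real n)"
      using eventually_gt_at_top[of 0] by eventually_elim (rule energy)
  qed simp
  then have small: "AE w in M. \<forall>m. (INF n\<in>{m..}. edge_functional (k n) w) = 0"
    by (rule AE_edge_functional_small[OF k_meas])
  have "(\<integral>\<^sup>+w. edge_functional (\<lambda>x y. indicator (cball 0 (real m)) x) w \<partial>M) < \<infinity>" for m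
  proof -
    let ?c = "\<lambda>(x::real^2) (y::real^2). indicator (cball 0 (real m)) x :: real"
    have c: "(\<lambda>(x, y). ?c x y) \<in> borel_measurable (borel \<Otimes>\<^sub>M borel)"
      by (rule measurable_indicator_fst) simp
    have "(\<integral>\<^sup>+w. edge_functional ?c w \<partial>M) =
        ennreal (\<rho>\<^sup>2) * (\<integral>\<^sup>+x. \<integral>\<^sup>+y. ennreal (?c x y * g (x - y)) \<partial>lborel \<partial>lborel)"
      by (rule edge_functional_mean[OF \<rho> g c]) (auto simp: indicator_def)
    also have "\<dots> \<le> ennreal (\<rho>\<^sup>2) * (ennreal K *
        (\<integral>\<^sup>+x. \<integral>\<^sup>+y. ennreal (?c x y / (1 + dist x y) ^ 4) \<partial>lborel \<partial>lborel))"
      by (intro mult_left_mono kernel[OF c]) (auto simp: indicator_def)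
    also have "(\<integral>\<^sup>+x. \<integral>\<^sup>+y. ennreal (?c x y / (1 + dist x y) ^ 4) \<partial>lborel \<partial>lborel) \<le>
        (\<integral>\<^sup>+x. ennreal (2 * pi) * indicator (cball (0::real^2) (real m)) x \<partial>lborel)"
      using nn_integral_pow4_decay by (intro nn_integral_mono) (auto simp: indicator_def)
    also have "\<dots> = ennreal (2 * pi) * emeasure lborel (cball (0::real^2) (real m))"
      by (rule nn_integral_cmult_indicator) simp
    also have "ennreal (\<rho>\<^sup>2) * (ennreal K * \<dots>) < \<infinity>"
      using emeasure_lborel_cball_finite[of "0::real^2" "real m"]
      by (simp add: ennreal_mult_less_top)
    finally show ?thesis by (simp add: mult_left_mono)
  qed
  then have degrees: "AE w in M. \<forall>x. finite (E w `` {x})"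
    by (rule AE_finite_degrees)
  show ?thesis
    using AE_space points_distinct locally_finite small degrees
  proof eventually_elim
    case (elim w)
    note w = elim(1) and inj = elim(2) and lf = elim(3) and inf0 = elim(4) and fin = elim(5)
    let ?V = "range (\<lambda>n. X n w)"
    have graph: "E w \<subseteq> ?V \<times> ?V" "sym (E w)" using edges_graph[OF w] by auto
    show ?case
    proof (intro ballI impI)
      fix C assume C: "C \<in> graph_components ?V (E w)" "\<not> is_singleton C"
      have V: "countable ?V" by simp
      interpret locally_finite_component "E w" C
        using fin by (intro locally_finite_component_of_graph(1)[OF V graph _ C]) auto
      have CV: "C \<subseteq> ?V"
        using fin by (intro locally_finite_component_of_graph(2)[OF V graph _ C]) auto
      show "recurrent_component (E w) C"
      proof (rule recurrent_if_small_energy)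
        fix v and \<epsilon> :: real assume v: "v \<in> C" and \<epsilon>: "0 < \<epsilon>"
        \<comment> \<open>\<open>n \<ge> 2 * iter_log (norm v)\<close> gives \<open>log_cutoff n v \<ge> 1 / 2\<close>; the summand 1 keeps \<open>n\<close> positive.\<close>
        obtain m where m: "2 * iter_log (norm v) + 1 \<le> real m" using real_arch_simple by blast
        have "(INF n\<in>{m..}. edge_functional (k n) w) < ennreal \<epsilon>" using inf0 \<epsilon> by simp
        then obtain n where n: "m \<le> n" "edge_functional (k n) w < ennreal \<epsilon>"
          by (auto simp: INF_less_iff)
        have n0: "0 < n" "2 * iter_log (norm v) \<le> real n"
          using m n(1) iter_log_nonneg[of "norm v"] by auto
        have "{x \<in> C. log_cutoff n x \<noteq> 0} \<subseteq> ?V \<inter> cball 0 (exp (exp (real n) - 1) - 1)"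
        proof
          fix x assume x: "x \<in> {x \<in> C. log_cutoff n x \<noteq> 0}"
          then have "iter_log (norm x) \<le> real n" using log_cutoff_eq_0[OF n0(1), of x] by force
          then show "x \<in> ?V \<inter> cball 0 (exp (exp (real n) - 1) - 1)"
            using x CV iter_log_le_imp_le[of "norm x" n] by auto
        qed
        moreover have "finite (?V \<inter> cball 0 (exp (exp (real n) - 1) - 1))"
          using lf by auto
        ultimately have "finite {x \<in> C. log_cutoff n x \<noteq> 0}" by (rule finite_subset)
        moreover have "1 / 2 \<le> log_cutoff n v"
          using n0 by (simp add: log_cutoff_def field_simps)
        moreover have "(\<integral>\<^sup>+(x, y). ennreal ((log_cutoff n x - log_cutoff n y)\<^sup>2) \<partial>count_space (E w)) < ennreal \<epsilon>"
          using n(2) unfolding edge_functional_eq[OF w inj] k_def .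
        ultimately show "\<exists>f. finite {x \<in> C. f x \<noteq> 0} \<and> 1/2 \<le> f v \<and>
            (\<integral>\<^sup>+(x, y). ennreal ((f x - f y)\<^sup>2) \<partial>count_space (E w)) < ennreal \<epsilon>" by blast
      qed
    qed
  qed
qed

end
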